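(* Let $K$ be a number field of degree $d$, and let $S$, $K_S$ be as in the context. Let $\phi=(\phi_\sigma)_{\sigma\in S}:[0,1]\to K_S$ be a continuously differentiable map. Assume that for all but finitely many $x\in[0,1]$ there is a subset $S'\subset S$ (possibly depending on $x$) such that $\phi'_\sigma(x)\neq 0$ for all $\sigma\in S'$ and $$|\{\sigma\in S':\sigma\text{ is real}\}|+2\,|\{\sigma\in S':\sigma\text{ is complex}\}|>\left\lfloor \tfrac d2\right\rfloor .$$ Then the set $$\{x\in[0,1] : \phi(x)\in \mathrm{Bad}(K)\}$$ is winning in the sense of Schmidt (as a subset of $[0,1]$), and hence has Hausdorff dimension $1$.
   Context: Number field notation. $K$ is a number field of degree $d$ over $\mathbb{Q}$ with $r$ real embeddings and $s$ pairs of complex conjugate embeddings (so $d=r+2s$), and $\mathcal{O}_K$ is its ring of integers. $S$ denotes the set of field embeddings $\sigma$ of $K$ into $\mathbb{R}$ or $\mathbb{C}$, where from each complex conjugate pair $\sigma,\bar\sigma$ exactly one is chosen. $K_S:=\mathbb{R}^r\times\mathbb{C}^s$, with coordinates indexed by $S$ (real coordinates for real $\sigma$, complex coordinates for complex $\sigma$). Badly approximable vectors. A vector $\mathbf{x}=(x^\sigma)_{\sigma\in S}\in K_S$ is $K$-badly approximable, written $\mathbf{x}\in\mathrm{Bad}(K)$, if there exists $c>0$ such that for all $p,q\in\mathcal{O}_K$ with $q\neq0$, $$\max_{\sigma\in S}\{|\sigma(p)+x^\sigma\sigma(q)|\}\,\max_{\sigma\in S}\{|\sigma(q)|\}>c,$$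 where $|\cdot|$ is the usual real or complex absolute value (not squared at complex places). Schmidt's game. Let $X$ be a complete metric space (here $X=[0,1]$ with the usual metric), $W\subseteq X$, and $0<\alpha,\beta<1$. Balls are closed balls $B(x,\rho)$ with specified center and radius. Player A first chooses an arbitrary ball $A_0=B(x_0,\rho)$; Player B chooses a ball $B_0=B(y_0,\alpha\rho)\subset A_0$. In general, at step $n$ Player A chooses a ball $A_n=B(x_n,(\alpha\beta)^n\rho)\subset B_{n-1}$ and then Player B chooses a ball $B_n=B(y_n,\alpha(\alpha\beta)^n\rho)\subset A_n$. The intersection $\bigcap_n A_n$ is a single point $x_\infty$; Player B wins if $x_\infty\in W$. $W$ is $(\alpha,\beta)$-winning if Player B has a winning strategy, $\alpha$-winning if it is $(\alpha,\beta)$-winning for all $0<\beta<1$, and winning (in the sense of Schmidt) if it is $\alpha$-winning for some $\alpha>0$. *)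

theory Defs
  imports "HOL-Analysis.Analysis"
begin

section \<open>Number fields and their embeddings\<close>

definition number_field :: "'k::field_char_0 itself \<Rightarrow> bool" where
  "number_field _ \<longleftrightarrow>
     (\<exists>B. finite B \<and> module.span (\<lambda>(q::rat) (x::'k). of_rat q * x) B = (UNIV :: 'k set))"

definition field_degree :: "'k::field_char_0 itself \<Rightarrow> nat" where
  "field_degree _ = vector_space.dim (\<lambda>(q::rat) (x::'k). of_rat q * x) (UNIV :: 'k set)"

definition ring_of_integers :: "'k::field_char_0 set" where
  "ring_of_integers = {x. algebraic_int x}"

definition field_embedding :: "('k::field_char_0 \<Rightarrow> complex) \<Rightarrow> bool" where
  "field_embedding \<sigma> \<longleftrightarrow>
     \<sigma> 1 = 1 \<and> (\<forall>x y. \<sigma> (x + y) = \<sigma> x + \<sigma> y) \<and> (\<forall>x y. \<sigma> (x * y) = \<sigma> x * \<sigma> y)"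

definition real_embedding :: "('k::field_char_0 \<Rightarrow> complex) \<Rightarrow> bool" where
  "real_embedding \<sigma> \<longleftrightarrow> field_embedding \<sigma> \<and> range \<sigma> \<subseteq> \<real>"

definition complex_embedding :: "('k::field_char_0 \<Rightarrow> complex) \<Rightarrow> bool" where
  "complex_embedding \<sigma> \<longleftrightarrow> field_embedding \<sigma> \<and> \<not> range \<sigma> \<subseteq> \<real>"

(* For a real embedding \<tau> both alternatives below say \<sigma> = \<tau>, so S contains every real
   embedding and exactly one member of each pair of complex conjugate ones. *)
definition embedding_representatives :: "('k::field_char_0 \<Rightarrow> complex) set \<Rightarrow> bool" where
  "embedding_representatives S \<longleftrightarrow>
     (\<forall>\<sigma>\<in>S. field_embedding \<sigma>) \<and>
     (\<forall>\<tau>. field_embedding \<tau> \<longrightarrow> (\<exists>!\<sigma>. \<sigma> \<in> S \<and> (\<sigma> = \<tau> \<or> \<sigma> = (\<lambda>x. cnj (\<tau> x)))))"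

definition K_space ::
    "('k::field_char_0 \<Rightarrow> complex) set \<Rightarrow> (('k \<Rightarrow> complex) \<Rightarrow> complex) set" where
  "K_space S = (\<Pi>\<^sub>E \<sigma>\<in>S. if real_embedding \<sigma> then \<real> else UNIV)"

section \<open>Badly approximable vectors\<close>

(* S is finite and nonempty when 'k is a number field, so both maxima exist. *)
definition Bad ::
    "('k::field_char_0 \<Rightarrow> complex) set \<Rightarrow> (('k \<Rightarrow> complex) \<Rightarrow> complex) set" where
  "Bad S = {x \<in> K_space S. \<exists>c>0. \<forall>p\<in>ring_of_integers. \<forall>q\<in>ring_of_integers. q \<noteq> 0 \<longrightarrow>
     Max ((\<lambda>\<sigma>. cmod (\<sigma> p + x \<sigma> * \<sigma> q)) ` S) * Max ((\<lambda>\<sigma>. cmod (\<sigma> q)) ` S) > c}"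

section \<open>Schmidt's game\<close>

(* The space X is a subset of the ambient metric type; its closed balls are the traces on X of
   the ambient closed balls centred in X, and one ball lies in another iff it does as a set. *)
definition ball_in :: "'a::metric_space set \<Rightarrow> 'a \<Rightarrow> real \<Rightarrow> 'a set" where
  "ball_in X x r = cball x r \<inter> X"

definition A_ball :: "'a::metric_space set \<Rightarrow> real \<Rightarrow> real \<Rightarrow> real \<Rightarrow> (nat \<Rightarrow> 'a) \<Rightarrow> nat \<Rightarrow> 'a set" where
  "A_ball X \<alpha> \<beta> \<rho> x n = ball_in X (x n) ((\<alpha> * \<beta>) ^ n * \<rho>)"

definition B_ball :: "'a::metric_space set \<Rightarrow> real \<Rightarrow> real \<Rightarrow> real \<Rightarrow> (nat \<Rightarrow> 'a) \<Rightarrow> nat \<Rightarrow> 'a set" where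
  "B_ball X \<alpha> \<beta> \<rho> y n = ball_in X (y n) (\<alpha> * (\<alpha> * \<beta>) ^ n * \<rho>)"

definition legal_A ::
    "'a::metric_space set \<Rightarrow> real \<Rightarrow> real \<Rightarrow> real \<Rightarrow> (nat \<Rightarrow> 'a) \<Rightarrow> (nat \<Rightarrow> 'a) \<Rightarrow> nat \<Rightarrow> bool" where
  "legal_A X \<alpha> \<beta> \<rho> x y n \<longleftrightarrow>
     x n \<in> X \<and> (\<forall>m. n = Suc m \<longrightarrow> A_ball X \<alpha> \<beta> \<rho> x n \<subseteq> B_ball X \<alpha> \<beta> \<rho> y m)"

definition legal_B ::
    "'a::metric_space set \<Rightarrow> real \<Rightarrow> real \<Rightarrow> real \<Rightarrow> (nat \<Rightarrow> 'a) \<Rightarrow> (nat \<Rightarrow> 'a) \<Rightarrow> nat \<Rightarrow> bool" where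
  "legal_B X \<alpha> \<beta> \<rho> x y n \<longleftrightarrow>
     y n \<in> X \<and> B_ball X \<alpha> \<beta> \<rho> y n \<subseteq> A_ball X \<alpha> \<beta> \<rho> x n"

(* A strategy f sends the initial radius and the centres x 0, ..., x n played so far by A to B's
   next centre; the radii are forced and B's earlier centres are determined by f. Legality of B's
   moves is required at every finite stage, since an illegal move of B could leave A without a
   legal reply and so without any complete play to win. *)
definition winning_strategy ::
    "'a::metric_space set \<Rightarrow> real \<Rightarrow> real \<Rightarrow> 'a set \<Rightarrow> (real \<Rightarrow> 'a list \<Rightarrow> 'a) \<Rightarrow> bool" where
  "winning_strategy X \<alpha> \<beta> W f \<longleftrightarrow>
     (\<forall>\<rho>>0. \<forall>x y. (\<forall>n. y n = f \<rho> (map x [0..<Suc n])) \<longrightarrow>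
        (\<forall>n. (\<forall>k\<le>n. legal_A X \<alpha> \<beta> \<rho> x y k) \<longrightarrow> legal_B X \<alpha> \<beta> \<rho> x y n) \<and>
        ((\<forall>n. legal_A X \<alpha> \<beta> \<rho> x y n) \<longrightarrow>
           (\<exists>x_inf\<in>W. (\<Inter>n. A_ball X \<alpha> \<beta> \<rho> x n) = {x_inf})))"

definition alpha_beta_winning :: "'a::metric_space set \<Rightarrow> real \<Rightarrow> real \<Rightarrow> 'a set \<Rightarrow> bool" where
  "alpha_beta_winning X \<alpha> \<beta> W \<longleftrightarrow> W \<subseteq> X \<and> (\<exists>f. winning_strategy X \<alpha> \<beta> W f)"

definition alpha_winning :: "'a::metric_space set \<Rightarrow> real \<Rightarrow> 'a set \<Rightarrow> bool" where
  "alpha_winning X \<alpha> W \<longleftrightarrow> (\<forall>\<beta>. 0 < \<beta> \<and> \<beta> < 1 \<longrightarrow> alpha_beta_winning X \<alpha> \<beta> W)"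

definition schmidt_winning :: "'a::metric_space set \<Rightarrow> 'a set \<Rightarrow> bool" where
  "schmidt_winning X W \<longleftrightarrow> (\<exists>\<alpha>. 0 < \<alpha> \<and> \<alpha> < 1 \<and> alpha_winning X \<alpha> W)"

section \<open>Hausdorff dimension\<close>

(* Boundedness is part of the condition because diameter is a real number, with no meaningful
   value on unbounded sets. *)
definition hausdorff_premeasure :: "real \<Rightarrow> real \<Rightarrow> 'a::metric_space set \<Rightarrow> ennreal" where
  "hausdorff_premeasure s \<delta> A =
     Inf {(\<Sum>i. ennreal (diameter (U i) powr s)) | U :: nat \<Rightarrow> 'a set.
            A \<subseteq> (\<Union>i. U i) \<and> (\<forall>i. bounded (U i) \<and> diameter (U i) \<le> \<delta>)}"

definition hausdorff_measure :: "real \<Rightarrow> 'a::metric_space set \<Rightarrow> ennreal" where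
  "hausdorff_measure s A = (SUP \<delta>\<in>{0<..}. hausdorff_premeasure s \<delta> A)"

(* Only s > 0 enters; this leaves the infimum unchanged and avoids the value 0 powr 0 = 0. *)
definition hausdorff_dim :: "'a::metric_space set \<Rightarrow> ennreal" where
  "hausdorff_dim A = Inf {ennreal s | s. s > 0 \<and> hausdorff_measure s A = 0}"

end

theory Submission
  imports Defs "Jordan_Normal_Form.Determinant" "HOL-Library.Function_Algebras"
    "HOL-Computational_Algebra.Fundamental_Theorem_Algebra"
begin

text \<open>
  Write \<open>H q\<close> for the maximum of \<open>\<bar>\<sigma> q\<bar>\<close> over all places and \<open>M q\<close> for the maximum over a set \<open>A\<close> of
  places at which \<open>\<phi>'\<close> does not vanish and which carries more than half of the total weight \<open>d\<close>.
  Since the norm of \<open>q \<noteq> 0\<close> is at least 1, \<open>H q * M q \<ge> 1\<close>. On a ball of radius \<open>r\<close> of Schmidt's game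
  consider all \<open>(p, q)\<close> with \<open>H q * M q\<close> of size about \<open>\<kappa> / r\<close> such that \<open>\<bar>\<sigma> p + \<phi>\<^sub>\<sigma> \<sigma> q\<bar> \<le> c / H q\<close> for
  all \<open>\<sigma>\<close> somewhere on the ball. For two such pairs the norm of \<open>p q' - p' q\<close> is less than 1, so all of
  them share one value \<open>p / q\<close>; the points of the ball with such an approximation then lie in at most
  one short interval for each \<open>\<sigma> \<in> A\<close>, namely the place at which \<open>\<bar>\<sigma> q\<bar> = M q\<close>. Player B can avoid
  that many short intervals at once. Until the ball is small enough for one set \<open>A\<close> to work on all
  of it, Player B avoids the exceptional points instead.

  The norm bound comes from the regular representation: the embeddings diagonalise multiplication
  by \<open>x\<close>, and the matrices of all powers of an algebraic integer have a common denominator \<open>D\<close>, so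
  \<open>D ^ d * Norm x ^ k\<close> is a nonzero integer for every \<open>k\<close>. For the dimension, Player A follows the base
  \<open>N\<close> digits of a real number, which yields a subset of the winning set with a surjection onto the
  unit interval that is Hoelder continuous of an exponent arbitrarily close to 1.
\<close>

section \<open>Embeddings of number fields\<close>

interpretation Q: vector_space "\<lambda>(q::rat) (x::'a::field_char_0). of_rat q * x"
  by unfold_locales (auto simp: algebra_simps of_rat_add of_rat_mult)

interpretation Z: Modules.module "\<lambda>(n::int) (x::'a::comm_ring_1). of_int n * x"
  by unfold_locales (auto simp: algebra_simps)

interpretation C: vector_space "\<lambda>(c::complex) (f::'a \<Rightarrow> complex) x. c * f x"
  by unfold_locales (auto simp: algebra_simps)

lemma sum_fun_apply: "(\<Sum>i\<in>A. f i) x = (\<Sum>i\<in>A. f i x)"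
  for f :: "'b \<Rightarrow> 'a \<Rightarrow> complex"
  by (induction A rule: infinite_finite_induct) auto

lemma
  assumes "field_embedding \<sigma>"
  shows embedding_one: "\<sigma> 1 = 1"
    and embedding_add: "\<sigma> (x + y) = \<sigma> x + \<sigma> y"
    and embedding_mult: "\<sigma> (x * y) = \<sigma> x * \<sigma> y"
    and embedding_diff: "\<sigma> (x - y) = \<sigma> x - \<sigma> y"
    and embedding_of_rat: "\<sigma> (of_rat q) = of_rat q"
    and embedding_power: "\<sigma> (x ^ n) = \<sigma> x ^ n"
    and embedding_eq_0_iff: "\<sigma> x = 0 \<longleftrightarrow> x = 0"
proof -
  show one: "\<sigma> 1 = 1" and add: "\<sigma> (x + y) = \<sigma> x + \<sigma> y" and mult: "\<sigma> (x * y) = \<sigma> x * \<sigma> y" for x y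
    using assms by (auto simp: field_embedding_def)
  have zero: "\<sigma> 0 = 0" using add[of 0 0] by simp
  have minus: "\<sigma> (- x) = - \<sigma> x" for x using add[of x "- x"] zero by (simp add: eq_neg_iff_add_eq_0 add.commute)
  show diff: "\<sigma> (x - y) = \<sigma> x - \<sigma> y" for x y using add[of x "- y"] minus by simp
  have nat: "\<sigma> (of_nat n) = of_nat n" for n by (induction n) (auto simp: zero one add)
  have int: "\<sigma> (of_int k) = of_int k" for k
    by (cases k rule: int_cases2) (auto simp: minus nat)
  show eq_0: "\<sigma> x = 0 \<longleftrightarrow> x = 0" for x
  proof
    assume "\<sigma> x = 0"
    show "x = 0"
    proof (rule ccontr)
      assume "x \<noteq> 0"
      then have "1 = \<sigma> (x * inverse x)" using one by simp
      then show False using \<open>\<sigma> x = 0\<close> mult[of x "inverse x"] by simp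
    qed
  qed (simp add: zero)
  show "\<sigma> (of_rat q) = of_rat q"
  proof (cases q)
    case (Fract a b)
    then have "of_int b * of_rat q = (of_int a :: 'a)" "of_int b * of_rat q = (of_int a :: complex)"
      by (auto simp: of_rat_rat)
    then have "of_int b * \<sigma> (of_rat q) = of_int b * of_rat q"
      by (metis int mult)
    then show ?thesis using Fract by simp
  qed
  show "\<sigma> (x ^ n) = \<sigma> x ^ n" by (induction n) (auto simp: one mult)
qed

section \<open>Rational linear functionals and Dedekind independence of embeddings\<close>

definition rat_linear :: "('k::field_char_0 \<Rightarrow> complex) \<Rightarrow> bool" where
  "rat_linear g \<longleftrightarrow> (\<forall>x y. g (x + y) = g x + g y) \<and> (\<forall>q x. g (of_rat q * x) = of_rat q * g x)"

lemma rat_linear_sum: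
  assumes "rat_linear g"
  shows "g (\<Sum>i\<in>A. f i) = (\<Sum>i\<in>A. g (f i))"
proof -
  have "g 0 = 0" using assms unfolding rat_linear_def by (metis mult_zero_left of_rat_0)
  then show ?thesis
    using assms by (induction A rule: infinite_finite_induct) (auto simp: rat_linear_def)
qed

lemma embedding_rat_linear: "field_embedding \<sigma> \<Longrightarrow> rat_linear \<sigma>"
  by (auto simp: rat_linear_def embedding_add embedding_mult embedding_of_rat)

text \<open>Dedekind's argument: pick \<open>y\<close> with
  \<open>\<sigma> y \<noteq> \<tau> y\<close>. Replacing \<open>x\<close> by \<open>y * x\<close> in
  the relation and subtracting \<open>\<tau> y\<close> times the relation removes \<tau>, so the
  induction hypothesis gives \<open>a \<sigma> = 0\<close>; the value at 1 then kills
  \<open>a \<tau>\<close>.\<close>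

lemma embeddings_independent_finite:
  assumes "finite A" "\<And>\<sigma>. \<sigma> \<in> A \<Longrightarrow> field_embedding \<sigma>" "\<And>x. (\<Sum>\<sigma>\<in>A. a \<sigma> * \<sigma> x) = 0" "\<sigma> \<in> A"
  shows "a \<sigma> = 0"
  using assms
proof (induction A arbitrary: a \<sigma> rule: finite_induct)
  case (insert \<tau> A)
  have rel: "a \<tau> * \<tau> x + (\<Sum>\<sigma>\<in>A. a \<sigma> * \<sigma> x) = 0" for x
    using insert.prems(2)[of x] insert.hyps by simp
  have 0: "a \<sigma> = 0" if \<sigma>: "\<sigma> \<in> A" for \<sigma>
  proof -
    have "\<sigma> \<noteq> \<tau>" using \<sigma> insert.hyps by auto
    then obtain y where y: "\<sigma> y \<noteq> \<tau> y" by auto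
    have "(\<Sum>\<sigma>\<in>A. a \<sigma> * (\<sigma> y - \<tau> y) * \<sigma> x) = 0" for x
    proof -
      have "(\<Sum>\<sigma>\<in>A. a \<sigma> * (\<sigma> y - \<tau> y) * \<sigma> x) =
          (a \<tau> * \<tau> (y * x) + (\<Sum>\<sigma>\<in>A. a \<sigma> * \<sigma> (y * x))) - \<tau> y * (a \<tau> * \<tau> x + (\<Sum>\<sigma>\<in>A. a \<sigma> * \<sigma> x))"
        using insert.prems(1)
        by (simp add: embedding_mult sum_distrib_left algebra_simps sum_subtractf)
      then show ?thesis by (simp add: rel)
    qed
    then have "a \<sigma> * (\<sigma> y - \<tau> y) = 0"
      using insert.IH[of "\<lambda>\<sigma>. a \<sigma> * (\<sigma> y - \<tau> y)" \<sigma>] insert.prems(1) \<sigma> by auto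
    then show ?thesis using y by simp
  qed
  have "a \<tau> = 0" using rel[of 1] 0 insert.prems(1) by (simp add: embedding_one)
  then show ?case using 0 insert.prems(3) by auto
qed simp

section \<open>Polynomials in a shift operator and its eigenfunctions\<close>

definition shift_act :: "complex poly \<Rightarrow> 'k::field_char_0 \<Rightarrow> ('k \<Rightarrow> complex) \<Rightarrow> 'k \<Rightarrow> complex" where
  "shift_act P b g x = (\<Sum>i\<le>degree P. coeff P i * g (b ^ i * x))"

lemma shift_act_bound:
  assumes "degree P \<le> n"
  shows "shift_act P b g x = (\<Sum>i\<le>n. coeff P i * g (b ^ i * x))"
  unfolding shift_act_def using assms
  by (intro sum.mono_neutral_left) (auto simp: coeff_eq_0)

text \<open>\<open>shift_act P b g\<close> is the polynomial \<open>P\<close>, taken in the operator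
  that multiplies the argument by \<open>b\<close>, applied to \<open>g\<close>. In a product of
  polynomials one factor can act first, which peels off one root at a time.\<close>

lemma shift_act_linear_factor:
  "shift_act ([:- \<alpha>, 1:] * P) b g x = shift_act P b (\<lambda>x. g (b * x) - \<alpha> * g x) x"
proof -
  let ?n = "degree P"
  have PP: "[:- \<alpha>, 1:] * P = pCons 0 P - Polynomial.smult \<alpha> P" by (simp add: algebra_simps)
  have deg: "degree ([:- \<alpha>, 1:] * P) \<le> Suc ?n"
    by (rule order_trans[OF degree_mult_le]) simp
  have "shift_act ([:- \<alpha>, 1:] * P) b g x = (\<Sum>i\<le>Suc ?n. coeff (pCons 0 P - Polynomial.smult \<alpha> P) i * g (b ^ i * x))"
    using shift_act_bound[OF deg] unfolding PP .
  also have "\<dots> = (\<Sum>i\<le>Suc ?n. coeff (pCons 0 P) i * g (b ^ i * x)) - \<alpha> * (\<Sum>i\<le>Suc ?n. coeff P i * g (b ^ i * x))"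
    by (simp only: coeff_diff coeff_smult left_diff_distrib sum_subtractf sum_distrib_left mult.assoc)
  also have "(\<Sum>i\<le>Suc ?n. coeff (pCons 0 P) i * g (b ^ i * x)) = (\<Sum>i\<le>?n. coeff P i * g (b ^ i * (b * x)))"
    by (simp add: sum.atMost_Suc_shift mult_ac del: sum.atMost_Suc)
  also have "(\<Sum>i\<le>Suc ?n. coeff P i * g (b ^ i * x)) = (\<Sum>i\<le>?n. coeff P i * g (b ^ i * x))"
    by (simp add: coeff_eq_0)
  finally show ?thesis
    by (simp add: shift_act_def algebra_simps sum_subtractf sum_distrib_left)
qed

text \<open>Induction on the roots: once the image of \<open>g\<close> under shift minus \<beta> is
  split into eigenfunctions, dividing each by \<open>\<alpha> - \<beta>\<close> lifts the splitting
  to \<open>g\<close>, up to an eigenfunction for \<beta>. The invariant subspace \<open>M\<close>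
  carries along further properties, such as eigenvalues for other shifts.\<close>

lemma eigenfunction_decomposition:
  fixes M :: "('k::field_char_0 \<Rightarrow> complex) set"
  assumes "finite A" and M: "C.subspace M" "\<And>g. g \<in> M \<Longrightarrow> (\<lambda>x. g (b * x)) \<in> M"
    and "g \<in> M" "\<And>x. shift_act (\<Prod>\<alpha>\<in>A. [:- \<alpha>, 1:]) b g x = 0"
  shows "\<exists>h. (\<forall>\<alpha>\<in>A. h \<alpha> \<in> M \<and> (\<forall>x. h \<alpha> (b * x) = \<alpha> * h \<alpha> x)) \<and> g = (\<Sum>\<alpha>\<in>A. h \<alpha>)"
  using assms(1,4,5)
proof (induction A arbitrary: g rule: finite_induct)
  case empty
  then have "g x = 0" for x using empty(2)[of x] by (simp add: shift_act_def)
  then show ?case by auto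
next
  case (insert \<beta> A)
  define g1 where "g1 = (\<lambda>x. g (b * x) - \<beta> * g x)"
  have "(\<lambda>x. g (b * x)) - (\<lambda>x. \<beta> * g x) \<in> M"
    by (intro C.subspace_diff C.subspace_scale M insert.prems)
  then have g1: "g1 \<in> M" by (simp add: g1_def fun_diff_def)
  have "shift_act (\<Prod>\<alpha>\<in>A. [:- \<alpha>, 1:]) b g1 x = 0" for x
    using insert.prems(2)[of x]
    unfolding prod.insert[OF insert.hyps(1,2)] shift_act_linear_factor g1_def .
  then obtain h where h: "\<And>\<alpha>. \<alpha> \<in> A \<Longrightarrow> h \<alpha> \<in> M" "\<And>\<alpha> x. \<alpha> \<in> A \<Longrightarrow> h \<alpha> (b * x) = \<alpha> * h \<alpha> x"
    and g1h: "g1 = (\<Sum>\<alpha>\<in>A. h \<alpha>)"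
    using insert.IH[OF g1] by blast
  define k where "k = (\<lambda>\<alpha> x. 1 / (\<alpha> - \<beta>) * h \<alpha> x)"
  have kM: "k \<alpha> \<in> M" if "\<alpha> \<in> A" for \<alpha>
    unfolding k_def using M(1) h(1)[OF that] by (rule C.subspace_scale)
  have k: "k \<alpha> (b * x) = \<beta> * k \<alpha> x + h \<alpha> x" if "\<alpha> \<in> A" for \<alpha> x
  proof -
    have "\<alpha> - \<beta> \<noteq> 0" using that insert.hyps by auto
    then show ?thesis by (simp add: k_def h(2)[OF that] field_simps)
  qed
  define r where "r = g - (\<Sum>\<alpha>\<in>A. k \<alpha>)"
  have rM: "r \<in> M" unfolding r_def
    by (intro C.subspace_diff C.subspace_sum M insert.prems kM)
  have r: "r (b * x) = \<beta> * r x" for x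
  proof -
    have "g (b * x) = \<beta> * g x + (\<Sum>\<alpha>\<in>A. h \<alpha> x)"
      using fun_cong[OF g1h, of x] by (simp add: g1_def sum_fun_apply algebra_simps)
    then show ?thesis
      by (simp add: r_def sum_fun_apply k sum.distrib sum_distrib_left algebra_simps)
  qed
  have "g = r + (\<Sum>\<alpha>\<in>A. k \<alpha>)" by (simp add: r_def)
  also have "\<dots> = (\<Sum>\<alpha>\<in>insert \<beta> A. (k(\<beta> := r)) \<alpha>)"
  proof -
    have "(\<Sum>\<alpha>\<in>A. (k(\<beta> := r)) \<alpha>) = (\<Sum>\<alpha>\<in>A. k \<alpha>)"
      using insert.hyps by (intro sum.cong) auto
    then show ?thesis using insert.hyps by simp
  qed
  finally have "g = (\<Sum>\<alpha>\<in>insert \<beta> A. (k(\<beta> := r)) \<alpha>)" .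
  moreover have "k \<alpha> (b * x) = \<alpha> * k \<alpha> x" if "\<alpha> \<in> A" for \<alpha> x by (simp add: k_def h(2)[OF that])
  ultimately show ?case using rM r kM by (intro exI[of _ "k(\<beta> := r)"]) auto
qed

section \<open>Minimal polynomials over the rationals\<close>

abbreviation rpoly :: "rat poly \<Rightarrow> 'a::field_char_0 \<Rightarrow> 'a" where
  "rpoly p x \<equiv> poly (map_poly of_rat p) x"

lemma of_rat_poly_mult: "map_poly of_rat (p * q) = (map_poly of_rat p * map_poly of_rat q :: 'a::field_char_0 poly)"
  by (rule poly_eqI) (simp add: coeff_map_poly coeff_mult of_rat_sum of_rat_mult)

lemma of_rat_poly_add: "map_poly of_rat (p + q) = (map_poly of_rat p + map_poly of_rat q :: 'a::field_char_0 poly)"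
  by (rule poly_eqI) (simp add: coeff_map_poly of_rat_add)

lemma of_rat_poly_pderiv: "map_poly of_rat (pderiv p) = (pderiv (map_poly of_rat p) :: 'a::field_char_0 poly)"
  by (rule poly_eqI) (simp add: coeff_map_poly coeff_pderiv of_rat_mult of_rat_add)

lemma degree_of_rat_poly: "degree (map_poly of_rat p :: 'a::field_char_0 poly) = degree p"
  by (rule degree_map_poly) simp

text \<open>A minimal polynomial, characterised by least degree and not normalised to be
  monic.\<close>

definition min_annihilator :: "rat poly \<Rightarrow> 'a::field_char_0 \<Rightarrow> bool" where
  "min_annihilator f x \<longleftrightarrow> f \<noteq> 0 \<and> rpoly f x = 0 \<and> (\<forall>g. g \<noteq> 0 \<longrightarrow> rpoly g x = 0 \<longrightarrow> degree f \<le> degree g)"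

lemma min_annihilator_exists:
  fixes x :: "'a::field_char_0"
  assumes "p \<noteq> 0" "rpoly p x = 0"
  shows "\<exists>f. min_annihilator f x"
proof -
  let ?P = "\<lambda>f. f \<noteq> 0 \<and> rpoly f x = 0"
  have "?P (ARG_MIN degree f. ?P f) \<and> (\<forall>g. ?P g \<longrightarrow> degree (ARG_MIN degree f. ?P f) \<le> degree g)"
    by (rule arg_min_nat_lemma[of ?P p]) (use assms in auto)
  then show ?thesis unfolding min_annihilator_def by blast
qed

lemma min_annihilator_dvd:
  fixes x :: "'a::field_char_0"
  assumes f: "min_annihilator f x" and g: "rpoly g x = 0"
  shows "f dvd g"
proof -
  have "rpoly g x = rpoly (f * (g div f) + g mod f) x" by simp
  then have "rpoly (g mod f) x = 0"
    using f g unfolding of_rat_poly_add of_rat_poly_mult by (simp add: min_annihilator_def)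
  then have "g mod f = 0" using f degree_mod_less[of f g] unfolding min_annihilator_def
    by (meson leD)
  then show ?thesis by (rule mod_0_imp_dvd)
qed

text \<open>A multiple root \<open>z\<close> would have a minimal polynomial \<open>m\<close>
  dividing both \<open>f\<close> and \<open>pderiv f\<close>; the latter is nonzero in
  characteristic 0, so \<open>m\<close> has smaller degree than \<open>f\<close>. Writing
  \<open>f = m * h\<close>, one of the two proper factors would annihilate \<open>x\<close>, against
  minimality.\<close>

lemma min_annihilator_rsquarefree:
  fixes x :: "'a::field_char_0"
  assumes f: "min_annihilator f x"
  shows "rsquarefree (map_poly of_rat f :: complex poly)"
  unfolding rsquarefree_roots
proof (intro allI notI, elim conjE)
  fix z :: complex
  assume z: "rpoly f z = 0" "poly (pderiv (map_poly of_rat f)) z = 0"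
  have f0: "f \<noteq> 0" "rpoly f x = 0" using f by (auto simp: min_annihilator_def)
  obtain m where m: "min_annihilator m z" using min_annihilator_exists[OF f0(1) z(1)] by blast
  have m0: "m \<noteq> 0" "rpoly m z = 0" using m by (auto simp: min_annihilator_def)
  obtain h where h: "f = m * h" using min_annihilator_dvd[OF m z(1)] by (auto elim: dvdE)
  have degm: "degree m \<noteq> 0"
  proof
    assume "degree m = 0"
    then obtain c where "m = [:c:]" by (rule degree_eq_zeroE)
    then show False using m0 by (simp add: map_poly_pCons)
  qed
  then have degf: "degree f \<noteq> 0" using h f0 by (auto simp: degree_mult_eq)
  have "m dvd pderiv f" using min_annihilator_dvd[OF m, of "pderiv f"] z(2) by (simp add: of_rat_poly_pderiv)
  moreover have "pderiv f \<noteq> 0" using degf by (simp add: pderiv_eq_0_iff)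
  ultimately have "degree m \<le> degree f - 1" using dvd_imp_degree_le degree_pderiv by metis
  moreover have "rpoly m x = 0 \<or> rpoly h x = 0" using f0(2) by (simp add: h of_rat_poly_mult)
  then have "degree f \<le> degree m \<or> degree f \<le> degree h"
    using f m0(1) h f0(1) unfolding min_annihilator_def by auto
  moreover have "degree f = degree m + degree h" using h f0(1) by (auto simp: degree_mult_eq)
  ultimately show False using degm degf by linarith
qed

lemma finite_dim_annihilator:
  fixes x :: "'a::field_char_0"
  assumes "number_field TYPE('a)"
  shows "\<exists>p. p \<noteq> 0 \<and> rpoly p x = 0"
proof -
  obtain B :: "'a set" where B: "finite B" "Q.span B = UNIV" using assms by (auto simp: number_field_def)
  have monom_eval: "rpoly (monom c i) x = of_rat c * x ^ i" for c i
    by (simp add: map_poly_monom poly_monom)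
  show ?thesis
  \<comment> \<open>Linear dependence is a property of the set of powers, so a repetition among the
    powers is treated apart: it yields the annihilator \<open>X ^ i - X ^ j\<close>.\<close>
  proof (cases "inj (\<lambda>i::nat. x ^ i)")
    case False
    then obtain i j :: nat where ij: "i \<noteq> j" "x ^ i = x ^ j" by (auto simp: inj_def)
    have "rpoly (monom 1 i + monom (- 1) j) x = 0"
      unfolding of_rat_poly_add poly_add monom_eval using ij by (simp add: of_rat_minus)
    moreover have "coeff (monom 1 i + monom (- 1) j :: rat poly) i \<noteq> 0" using ij by simp
    then have "monom 1 i + monom (- 1) j \<noteq> (0 :: rat poly)" by force
    ultimately show ?thesis by blast
  next
    case True
    then have "infinite (range (\<lambda>i::nat. x ^ i))" by (simp add: finite_image_iff)
    then have "Q.dependent (range (\<lambda>i::nat. x ^ i))"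
      using Q.independent_span_bound[OF B(1), of "range (\<lambda>i::nat. x ^ i)"] B(2) by auto
    then obtain T u v where T: "finite T" "T \<subseteq> range (\<lambda>i::nat. x ^ i)" "(\<Sum>v\<in>T. of_rat (u v) * v) = 0"
      and v: "v \<in> T" "u v \<noteq> 0" unfolding Q.dependent_explicit by blast
    obtain I where I: "finite I" "T = (\<lambda>i::nat. x ^ i) ` I" using T finite_subset_image by metis
    define p where "p = (\<Sum>i\<in>I. monom (u (x ^ i)) i)"
    have eval_sum: "rpoly (\<Sum>i\<in>J. monom (u (x ^ i)) i) x = (\<Sum>i\<in>J. of_rat (u (x ^ i)) * x ^ i)" for J
      by (induction J rule: infinite_finite_induct) (auto simp: of_rat_poly_add monom_eval)
    have "rpoly p x = (\<Sum>v\<in>T. of_rat (u v) * v)"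
      unfolding p_def eval_sum I(2) using True by (subst sum.reindex) (auto simp: inj_on_def)
    moreover obtain i where "i \<in> I" "v = x ^ i" using v I by auto
    then have "coeff p i \<noteq> 0" using v I(1) by (simp add: p_def coeff_sum sum.delta)
    then have "p \<noteq> 0" by force
    ultimately show ?thesis using T by auto
  qed
qed

section \<open>Simultaneous diagonalisation of multiplications\<close>

lemma rat_linear_shift_act_eq_0:
  assumes g: "rat_linear g" and f: "rpoly f b = 0"
  shows "shift_act (map_poly of_rat f) b g x = 0"
proof -
  have "shift_act (map_poly of_rat f) b g x = (\<Sum>i\<le>degree f. g (of_rat (coeff f i) * (b ^ i * x)))"
    using g by (simp add: shift_act_def degree_of_rat_poly coeff_map_poly rat_linear_def)
  \<comment> \<open>By linearity, the polynomial \<open>f\<close> in the shift by \<open>b\<close>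
    acts on \<open>g\<close> as the substitution of \<open>rpoly f b * x\<close> for
    \<open>x\<close>.\<close>
  also have "\<dots> = g (rpoly f b * x)"
    by (simp add: rat_linear_sum[OF g, symmetric] poly_altdef degree_of_rat_poly coeff_map_poly
        sum_distrib_right mult.assoc)
  also have "\<dots> = 0" using g unfolding f rat_linear_def by (metis mult_zero_left of_rat_0)
  finally show ?thesis .
qed

text \<open>If \<open>B\<close> spans the field, such an \<open>h\<close> has an eigenvalue for
  every multiplication; when \<open>h 1\<close> is nonzero, the eigenvalue as a function of the
  multiplier is an embedding.\<close>

definition joint_eigen :: "'k::field_char_0 set \<Rightarrow> ('k \<Rightarrow> complex) set" where
  "joint_eigen B = {h. rat_linear h \<and> (\<forall>b\<in>B. \<exists>u. \<forall>x. h (b * x) = u * h x)}"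

text \<open>Multiplications commute, and each is annihilated by a polynomial with simple roots; so
  they can be diagonalised one after another.\<close>

lemma rat_linear_in_span_joint_eigen:
  fixes g :: "'k::field_char_0 \<Rightarrow> complex"
  assumes K: "number_field TYPE('k)" and "finite B" and g: "rat_linear g"
  shows "g \<in> C.span (joint_eigen B)"
  using assms(2)
proof (induction B rule: finite_induct)
  case empty
  show ?case using g by (intro C.span_base) (simp add: joint_eigen_def)
next
  case (insert b B)
  have "h \<in> C.span (joint_eigen (insert b B))" if h: "h \<in> joint_eigen B" for h
  proof -
    obtain u where u: "\<And>b' x. b' \<in> B \<Longrightarrow> h (b' * x) = u b' * h x"
      using h unfolding joint_eigen_def by (auto simp: bchoice_iff)
    \<comment> \<open>Commutativity makes this common eigenspace of the earlier multiplications
      stable under multiplication by \<open>b\<close>, so the new eigenfunctions keep their old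
      eigenvalues.\<close>
    define M where "M = {f. rat_linear f \<and> (\<forall>b'\<in>B. \<forall>x. f (b' * x) = u b' * f x)}"
    have M: "C.subspace M"
      by (auto simp: C.subspace_def M_def rat_linear_def algebra_simps)
    have shift: "(\<lambda>x. f (b * x)) \<in> M" if "f \<in> M" for f
    proof -
      have "f (b * (y * x)) = f (y * (b * x))" for x y by (simp add: mult_ac)
      then show ?thesis using that by (auto simp: M_def rat_linear_def distrib_left)
    qed
    obtain p where "p \<noteq> 0" "rpoly p b = 0" using finite_dim_annihilator[OF K] by blast
    then obtain f where f: "min_annihilator f b" using min_annihilator_exists by blast
    define F where "F = (map_poly of_rat f :: complex poly)"
    have F0: "F \<noteq> 0" using f by (auto simp: F_def min_annihilator_def map_poly_eq_0_iff)
    \<comment> \<open>Since the roots are simple, \<open>F\<close> is up to a constant the product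
      over its set of roots, the form that the eigenfunction decomposition requires.\<close>
    have split: "F = Polynomial.smult (lead_coeff F) (\<Prod>z | poly F z = 0. [:- z, 1:])"
      using complex_poly_decompose_rsquarefree[OF min_annihilator_rsquarefree[OF f]] by (simp add: F_def)
    have fin: "finite {z. poly F z = 0}" using F0 by (rule poly_roots_finite)
    have smult: "shift_act (Polynomial.smult c P) b h x = c * shift_act P b h x" if "c \<noteq> 0" for c P x
      using that by (simp add: shift_act_def sum_distrib_left mult_ac)
    have "shift_act (\<Prod>z | poly F z = 0. [:- z, 1:]) b h x = 0" for x
    proof -
      have "shift_act F b h x = 0" using rat_linear_shift_act_eq_0[of h f b x] h f
        by (simp add: F_def joint_eigen_def min_annihilator_def)
      moreover have "shift_act F b h x = lead_coeff F * shift_act (\<Prod>z | poly F z = 0. [:- z, 1:]) b h x"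
        using arg_cong[OF split, of "\<lambda>P. shift_act P b h x"] by (rule trans) (use F0 in \<open>simp add: smult\<close>)
      ultimately have "lead_coeff F * shift_act (\<Prod>z | poly F z = 0. [:- z, 1:]) b h x = 0" by simp
      then show ?thesis using F0 by simp
    qed
    moreover have "h \<in> M" using h u by (simp add: M_def joint_eigen_def)
    ultimately obtain k where k: "\<forall>\<alpha>\<in>{z. poly F z = 0}. k \<alpha> \<in> M \<and> (\<forall>x. k \<alpha> (b * x) = \<alpha> * k \<alpha> x)"
      and hk: "h = (\<Sum>\<alpha>\<in>{z. poly F z = 0}. k \<alpha>)"
      using eigenfunction_decomposition[OF fin M shift] by blast
    have "k \<alpha> \<in> joint_eigen (insert b B)" if "\<alpha> \<in> {z. poly F z = 0}" for \<alpha>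
      using k that by (auto simp: joint_eigen_def M_def)
    then show ?thesis unfolding hk by (intro C.span_sum C.span_base)
  qed
  then have "C.span (joint_eigen B) \<subseteq> C.span (joint_eigen (insert b B))"
    by (intro C.span_minimal C.subspace_span) auto
  then show ?case using insert.IH by blast
qed

text \<open>A joint eigenfunction \<open>h\<close> satisfies \<open>h (y * x) = u y * h x\<close>
  for all \<open>y\<close>, since eigenvalues extend linearly from \<open>B\<close>. Setting
  \<open>x\<close> to 1 shows that \<open>h\<close> is a multiple of \<open>u\<close>, and if
  \<open>h 1\<close> is nonzero, \<open>u\<close> inherits additivity and multiplicativity.\<close>

lemma rat_linear_in_span_embeddings:
  fixes g :: "'k::field_char_0 \<Rightarrow> complex"
  assumes K: "number_field TYPE('k)" and g: "rat_linear g"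
  shows "g \<in> C.span {\<sigma>. field_embedding \<sigma>}"
proof -
  obtain B :: "'k set" where B: "finite B" "Q.span B = UNIV" using K by (auto simp: number_field_def)
  have "h \<in> C.span {\<sigma>. field_embedding \<sigma>}" if h: "h \<in> joint_eigen B" for h
  proof -
    have lin: "h (x + y) = h x + h y" "h (of_rat q * x) = of_rat q * h x" for x y q
      using h by (auto simp: joint_eigen_def rat_linear_def)
    have "\<exists>u. \<forall>x. h (y * x) = u * h x" for y
    proof -
      have "y \<in> Q.span B" using B by simp
      then show ?thesis
      proof (induction y rule: Q.span_induct_alt)
        case base
        show ?case using lin(2)[of 0] by (intro exI[of _ 0]) simp
      next
        case (step c b y)
        obtain u where u: "\<forall>x. h (b * x) = u * h x" using h step.hyps by (auto simp: joint_eigen_def)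
        obtain v where v: "\<forall>x. h (y * x) = v * h x" using step.IH by blast
        show ?case
          by (intro exI[of _ "of_rat c * u + v"])
            (simp add: distrib_right lin mult.assoc u v)
      qed
    qed
    then obtain u where u: "\<And>y x. h (y * x) = u y * h x" by metis
    show ?thesis
    proof (cases "h 1 = 0")
      case True
      then have "h = 0" using u[of _ 1] by (auto simp: fun_eq_iff)
      then show ?thesis by (simp add: C.span_zero)
    next
      case False
      have hu: "h x = u x * h 1" for x using u[of x 1] by simp
      have "field_embedding u" unfolding field_embedding_def
      proof (intro conjI allI)
        show "u 1 = 1" using hu[of 1] False by simp
        show "u (x + y) = u x + u y" for x y
        proof -
          have "u (x + y) * h 1 = (u x + u y) * h 1"
            using lin(1)[of x y] unfolding hu[of x] hu[of y] hu[of "x + y"] by (simp add: distrib_right)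
          then show ?thesis using False by simp
        qed
        show "u (x * y) = u x * u y" for x y
        proof -
          have "u (x * y) * h 1 = u x * u y * h 1"
            using u[of x y] unfolding hu[of y] hu[of "x * y"] by simp
          then show ?thesis using False by simp
        qed
      qed
      then have "(\<lambda>x. h 1 * u x) \<in> C.span {\<sigma>. field_embedding \<sigma>}"
        by (intro C.span_scale C.span_base) simp
      moreover have "h = (\<lambda>x. h 1 * u x)"
        by (rule ext, subst hu) (rule mult.commute)
      ultimately show ?thesis by simp
    qed
  qed
  then have "C.span (joint_eigen B) \<subseteq> C.span {\<sigma>. field_embedding \<sigma>}"
    by (intro C.span_minimal C.subspace_span) auto
  then show ?thesis using rat_linear_in_span_joint_eigen[OF K B(1) g] by blast
qed

section \<open>Counting embeddings in a basis\<close>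

definition embeddings :: "('k::field_char_0 \<Rightarrow> complex) set" where
  "embeddings = {\<sigma>. field_embedding \<sigma>}"

locale numfield =
  fixes B :: "'k::field_char_0 set"
  assumes finite_basis: "finite B" and indep_basis: "Q.independent B" and span_basis: "Q.span B = UNIV"
begin

abbreviation crd :: "'k \<Rightarrow> 'k \<Rightarrow> rat" where "crd x b \<equiv> Q.representation B x b"

lemma number_field: "number_field TYPE('k)"
  using finite_basis span_basis by (auto simp: number_field_def)

lemma field_degree_eq: "field_degree TYPE('k) = card B"
  unfolding field_degree_def using Q.basis_card_eq_dim[of B UNIV] indep_basis span_basis by simp

lemma crd_add: "crd (x + y) b = crd x b + crd y b"
  using Q.representation_add[OF indep_basis] span_basis by simp

lemma crd_scale: "crd (of_rat q * x) b = q * crd x b"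
  using Q.representation_scale[OF indep_basis] span_basis by simp

lemma crd_of_int: "crd (of_int n * x) b = of_int n * crd x b"
  using crd_scale[of "of_int n" x b] by simp

lemma crd_zero: "crd 0 b = 0"
  using crd_scale[of 0 0 b] by simp

lemma crd_basis: "b \<in> B \<Longrightarrow> crd b b' = (if b' = b then 1 else 0)"
  using Q.representation_basis[OF indep_basis] by simp

lemma sum_crd: "(\<Sum>b\<in>B. of_rat (crd x b) * b) = x"
  using Q.sum_representation_eq[OF indep_basis _ finite_basis, of x] span_basis by simp

lemma rat_linear_crd: "rat_linear (\<lambda>x. of_rat (crd x b))"
  by (simp add: rat_linear_def crd_add crd_scale of_rat_add of_rat_mult)

lemma rat_linear_expand:
  assumes "rat_linear g"
  shows "g x = (\<Sum>b\<in>B. g b * of_rat (crd x b))"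
proof -
  have "g x = g (\<Sum>b\<in>B. of_rat (crd x b) * b)" by (simp add: sum_crd)
  also have "\<dots> = (\<Sum>b\<in>B. g (of_rat (crd x b) * b))" by (rule rat_linear_sum[OF assms])
  also have "\<dots> = (\<Sum>b\<in>B. g b * of_rat (crd x b))"
    using assms by (simp add: rat_linear_def mult.commute)
  finally show ?thesis .
qed

lemma embeddings_independent: "C.independent (embeddings :: ('k \<Rightarrow> complex) set)"
  unfolding C.independent_explicit_finite_subsets
proof (intro allI impI ballI)
  fix A u \<sigma>
  assume A: "A \<subseteq> (embeddings :: ('k \<Rightarrow> complex) set)" "finite A" "(\<Sum>v\<in>A. (\<lambda>x. u v * v x)) = 0" "\<sigma> \<in> A"
  have "(\<Sum>v\<in>A. u v * v x) = 0" for x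
    using fun_cong[OF A(3), of x] by (simp add: sum_fun_apply)
  then show "u \<sigma> = 0" using embeddings_independent_finite[of A u \<sigma>] A by (auto simp: embeddings_def)
qed

text \<open>The embeddings and the coordinate functionals are two independent families, each
  contained in the span of the other. Comparing sizes in both directions gives equality.\<close>

lemma finite_embeddings: "finite (embeddings :: ('k \<Rightarrow> complex) set)"
  and card_embeddings: "card (embeddings :: ('k \<Rightarrow> complex) set) = card B"
proof -
  define e where "e = (\<lambda>b::'k. \<lambda>x::'k. (of_rat (crd x b) :: complex))"
  have e: "e b x = of_rat (crd x b)" for b x by (simp add: e_def)
  have "g \<in> C.span (e ` B)" if "rat_linear g" for g
  proof -
    have "g = (\<Sum>b\<in>B. (\<lambda>x. g b * e b x))"
      by (rule ext) (simp add: sum_fun_apply e flip: rat_linear_expand[OF that])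
    moreover have "(\<Sum>b\<in>B. (\<lambda>x. g b * e b x)) \<in> C.span (e ` B)"
      by (intro C.span_sum C.span_scale C.span_base) auto
    ultimately show ?thesis by simp
  qed
  then have "embeddings \<subseteq> C.span (e ` B)" by (auto simp: embeddings_def embedding_rat_linear)
  then have fin: "finite (embeddings :: ('k \<Rightarrow> complex) set) \<and> card (embeddings :: ('k \<Rightarrow> complex) set) \<le> card (e ` B)"
    using C.independent_span_bound embeddings_independent finite_basis by blast
  then show "finite (embeddings :: ('k \<Rightarrow> complex) set)" ..
  have inj: "inj_on e B"
  proof (rule inj_onI)
    fix b b' assume b: "b \<in> B" "b' \<in> B" "e b = e b'"
    have "e b b = e b' b" using b by simp
    then show "b = b'" using b(1) by (auto simp: e crd_basis split: if_splits)
  qed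
  have "C.independent (e ` B)"
  proof (rule C.independent_if_scalars_zero)
    fix u f assume s: "(\<Sum>f\<in>e ` B. (\<lambda>x. u f * f x)) = 0" and "f \<in> e ` B"
    then obtain b where b: "b \<in> B" "f = e b" by auto
    have "0 = (\<Sum>f\<in>e ` B. (\<lambda>x. u f * f x)) b" using s by simp
    also have "\<dots> = (\<Sum>b'\<in>B. u (e b') * e b' b)" by (simp add: sum_fun_apply sum.reindex[OF inj])
    also have "\<dots> = (\<Sum>b'\<in>B. if b' = b then u (e b') else 0)" by (intro sum.cong) (auto simp: e crd_basis b)
    also have "\<dots> = u f" using b finite_basis by simp
    finally show "u f = 0" by simp
  qed (use finite_basis in simp)
  moreover have "e ` B \<subseteq> C.span embeddings"
    using rat_linear_in_span_embeddings[OF number_field] rat_linear_crd by (auto simp: embeddings_def e_def)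
  ultimately have "card (e ` B) \<le> card (embeddings :: ('k \<Rightarrow> complex) set)"
    using C.independent_span_bound fin by blast
  then show "card (embeddings :: ('k \<Rightarrow> complex) set) = card B" using fin card_image[OF inj] by simp
qed

section \<open>The norm as a determinant\<close>

lemma dual_coefficients:
  "\<exists>c. \<forall>b x. of_rat (crd x b) = (\<Sum>\<sigma>\<in>embeddings. c b \<sigma> * \<sigma> x)"
proof -
  have "\<exists>u. \<forall>x. of_rat (crd x b) = (\<Sum>\<sigma>\<in>embeddings. u \<sigma> * \<sigma> x)" for b
  proof -
    have "(\<lambda>x. of_rat (crd x b)) \<in> C.span embeddings"
      using rat_linear_in_span_embeddings[OF number_field] rat_linear_crd by (auto simp: embeddings_def)
    then obtain u where u: "(\<lambda>x. of_rat (crd x b)) = (\<Sum>\<sigma>\<in>embeddings. (\<lambda>x. u \<sigma> * \<sigma> x))"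
      unfolding C.span_finite[OF finite_embeddings] by auto
    have "of_rat (crd x b) = (\<Sum>\<sigma>\<in>embeddings. u \<sigma> * \<sigma> x)" for x
      using fun_cong[OF u, of x] by (simp add: sum_fun_apply)
    then show ?thesis by blast
  qed
  then show ?thesis by metis
qed

text \<open>Multiplication by \<open>x\<close> in the basis \<open>B\<close> is conjugate, via the matrix \<open>(\<sigma> b)\<close>, to the diagonal
  matrix of the \<open>\<sigma> x\<close>; so \<open>D ^ d * (\<Prod>\<sigma>. \<sigma> x)\<close> is the determinant of an integer matrix.\<close>

lemma norm_lower_bound_denominator:
  assumes x: "x \<noteq> 0" and D: "0 < D" "\<And>b b'. b \<in> B \<Longrightarrow> b' \<in> B \<Longrightarrow> of_int D * crd (x * b) b' \<in> \<int>"
  shows "1 \<le> real_of_int D ^ card B * (\<Prod>\<sigma>\<in>embeddings. cmod (\<sigma> x))"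
proof -
  define d where "d = card B"
  obtain h where h: "bij_betw h {0..<d} B"
    using ex_bij_betw_nat_finite[OF finite_basis] by (auto simp: d_def)
  obtain g where g: "bij_betw g {0..<d} (embeddings :: ('k \<Rightarrow> complex) set)"
    using ex_bij_betw_nat_finite[OF finite_embeddings] by (auto simp: d_def card_embeddings)
  obtain c where c: "\<And>b x. of_rat (crd x b) = (\<Sum>\<sigma>\<in>embeddings. c b \<sigma> * \<sigma> x)" using dual_coefficients by blast
  have hB: "h i \<in> B" if "i < d" for i using h that by (auto simp: bij_betw_def)
  have gE: "field_embedding (g i)" if "i < d" for i using g that by (auto simp: bij_betw_def embeddings_def)
  have sum_h: "(\<Sum>k\<in>{0..<d}. f (h k)) = (\<Sum>b\<in>B. f b)" for f :: "'k \<Rightarrow> complex"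
    using sum.reindex_bij_betw[OF h] .
  have sum_g: "(\<Sum>k\<in>{0..<d}. f (g k)) = (\<Sum>\<sigma>\<in>embeddings. f \<sigma>)" for f :: "('k \<Rightarrow> complex) \<Rightarrow> complex"
    using sum.reindex_bij_betw[OF g] .
  define V where "V = Matrix.mat d d (\<lambda>(i, j). g i (h j))"
  \<comment> \<open>With the coefficients dual to the embeddings as entries, \<open>W\<close>
    becomes a left inverse of \<open>V\<close>.\<close>
  define W where "W = Matrix.mat d d (\<lambda>(i, j). c (h i) (g j))"
  \<comment> \<open>The floor changes no value: by the hypothesis on \<open>D\<close> the entries
    are already integers.\<close>
  define M where "M = Matrix.mat d d (\<lambda>(i, j). \<lfloor>of_int D * crd (x * h j) (h i)\<rfloor>)"
  define A where "A = Matrix.mat d d (\<lambda>(i, j). if i = j then of_int D * g i x else 0)"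
  have M: "of_int (M $$ (i, j)) = complex_of_int D * of_rat (crd (x * h j) (h i))" if ij: "i < d" "j < d" for i j
  proof -
    obtain n where n: "of_int D * crd (x * h j) (h i) = of_int n"
      using D(2)[OF hB[OF ij(2)] hB[OF ij(1)]] by (rule Ints_cases)
    have "complex_of_int D * of_rat (crd (x * h j) (h i)) = of_rat (of_int D * crd (x * h j) (h i))"
      by (simp add: of_rat_mult)
    then show ?thesis using ij by (simp add: M_def n)
  qed
  let ?M = "map_mat complex_of_int M"
  have carr: "V \<in> carrier_mat d d" "W \<in> carrier_mat d d" "?M \<in> carrier_mat d d" "A \<in> carrier_mat d d"
    by (auto simp: V_def W_def M_def A_def)
  have "W * V = 1\<^sub>m d"
  proof (rule eq_matI)
    fix i j assume ij: "i < dim_row (1\<^sub>m d :: complex mat)" "j < dim_col (1\<^sub>m d :: complex mat)"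
    then have "(W * V) $$ (i, j) = (\<Sum>k\<in>{0..<d}. c (h i) (g k) * g k (h j))"
      by (simp add: W_def V_def scalar_prod_def)
    also have "\<dots> = of_rat (crd (h j) (h i))" unfolding sum_g[of "\<lambda>\<sigma>. c (h i) \<sigma> * \<sigma> (h j)"] c ..
    also have "\<dots> = 1\<^sub>m d $$ (i, j)"
      using ij h hB by (auto simp: crd_basis bij_betw_def inj_on_def)
    finally show "(W * V) $$ (i, j) = 1\<^sub>m d $$ (i, j)" .
  qed (auto simp: W_def V_def)
  then have "Determinant.det W * Determinant.det V = 1"
    using Determinant.det_mult[OF carr(2,1)] by simp
  then have V0: "Determinant.det V \<noteq> 0" by auto
  have VM: "V * ?M = A * V"
  proof (rule eq_matI)
    fix i j assume "i < dim_row (A * V)" "j < dim_col (A * V)"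
    then have ij: "i < d" "j < d" by (auto simp: A_def V_def)
    have "(V * ?M) $$ (i, j) = (\<Sum>k\<in>{0..<d}. g i (h k) * of_int (M $$ (k, j)))"
      using ij carr by (simp add: V_def M_def scalar_prod_def)
    also have "\<dots> = of_int D * (\<Sum>k\<in>{0..<d}. g i (h k) * of_rat (crd (x * h j) (h k)))"
      unfolding sum_distrib_left using ij by (intro sum.cong) (auto simp: M)
    also have "\<dots> = of_int D * g i (x * h j)"
      unfolding sum_h[of "\<lambda>b. g i b * of_rat (crd (x * h j) b)"]
      using rat_linear_expand[OF embedding_rat_linear[OF gE[OF ij(1)]], of "x * h j"] by simp
    also have "\<dots> = of_int D * g i x * g i (h j)" using gE[OF ij(1)] by (simp add: embedding_mult)
    also have "\<dots> = (\<Sum>k\<in>{0..<d}. (if i = k then of_int D * g i x else 0) * g k (h j))"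
      using ij by (simp add: if_distrib[of "\<lambda>a. a * _"] cong: if_cong)
    also have "\<dots> = (A * V) $$ (i, j)" using ij by (simp add: A_def V_def scalar_prod_def)
    finally show "(V * ?M) $$ (i, j) = (A * V) $$ (i, j)" .
  qed (auto simp: V_def A_def M_def)
  have "Determinant.det V * Determinant.det ?M = Determinant.det A * Determinant.det V"
    unfolding Determinant.det_mult[OF carr(1,3), symmetric] Determinant.det_mult[OF carr(4,1), symmetric] VM ..
  then have "Determinant.det ?M = Determinant.det A" using V0 by simp
  also have "Determinant.det A = prod_list (diag_mat A)"
    by (rule det_upper_triangular[OF _ carr(4)]) (auto simp: A_def)
  also have "\<dots> = (\<Prod>i\<in>{0..<d}. of_int D * g i x)"
    by (simp add: prod_list_diag_prod A_def)
  finally have "of_int (Determinant.det M) = (\<Prod>i\<in>{0..<d}. of_int D * g i x)"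
    by (simp add: of_int_hom.hom_det)
  then have "cmod (of_int (Determinant.det M)) = cmod (\<Prod>i\<in>{0..<d}. of_int D * g i x)" by simp
  also have "\<dots> = (\<Prod>i\<in>{0..<d}. real_of_int D * cmod (g i x))"
    using D(1) by (simp add: norm_mult flip: prod_norm)
  also have "\<dots> = real_of_int D ^ d * (\<Prod>i\<in>{0..<d}. cmod (g i x))" by (simp add: prod.distrib)
  also have "(\<Prod>i\<in>{0..<d}. cmod (g i x)) = (\<Prod>\<sigma>\<in>embeddings. cmod (\<sigma> x))"
    by (rule prod.reindex_bij_betw[OF g])
  finally have eq: "\<bar>real_of_int (Determinant.det M)\<bar> = real_of_int D ^ d * (\<Prod>\<sigma>\<in>embeddings. cmod (\<sigma> x))" by simp
  moreover have "(\<Prod>\<sigma>\<in>embeddings. cmod (\<sigma> x)) \<noteq> 0"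
    using x finite_embeddings by (auto simp: embeddings_def embedding_eq_0_iff)
  ultimately have "Determinant.det M \<noteq> 0" using D(1) by auto
  then have "1 \<le> \<bar>real_of_int (Determinant.det M)\<bar>" by linarith
  then show ?thesis using eq by (simp add: d_def)
qed

text \<open>A common denominator \<open>D\<close> of the coordinates of all products of
  \<open>F\<close> with the basis clears the matrices of all powers of \<open>x\<close> at once. If
  the norm \<open>P\<close> were below 1, the bound \<open>1 \<le> D ^ card B * P ^ k\<close> would
  fail for large \<open>k\<close>.\<close>

lemma norm_lower_bound_powers:
  fixes x :: 'k
  assumes x: "x \<noteq> 0" and F: "finite F" "\<And>k. x ^ k \<in> Z.span F"
  shows "1 \<le> (\<Prod>\<sigma>\<in>embeddings. cmod (\<sigma> x))"
proof (rule ccontr)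
  have common: "\<exists>D::int. 0 < D \<and> (\<forall>a\<in>A. of_int D * a \<in> \<int>)" if "finite A" for A :: "rat set"
    using that
  proof (induction A rule: finite_induct)
    case (insert a A)
    then obtain D :: int where D: "0 < D" "\<forall>a\<in>A. of_int D * a \<in> \<int>" by blast
    obtain m n :: int where a: "a = Rat.Fract m n" "0 < n" by (cases a) auto
    have "of_int n * a = of_int m" using a by (simp add: Fract_of_int_quotient)
    then have "of_int (D * n) * a = of_int (D * m)" by (simp add: mult.assoc)
    then have "of_int (D * n) * a \<in> \<int>" by (metis Ints_of_int)
    moreover have "of_int (D * n) * a' \<in> \<int>" if "a' \<in> A" for a'
    proof -
      have "of_int (D * n) * a' = of_int n * (of_int D * a')" by simp
      then show ?thesis using D(2) that by (metis Ints_mult Ints_of_int)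
    qed
    ultimately show ?case using D(1) a(2) by (intro exI[of _ "D * n"]) auto
  qed (intro exI[of _ 1]; simp)
  define A where "A = (\<lambda>(f, b, b'). crd (f * b) b') ` (F \<times> B \<times> B)"
  have "finite A" using F(1) finite_basis by (simp add: A_def)
  then obtain D :: int where D: "0 < D" "\<forall>a\<in>A. of_int D * a \<in> \<int>" using common by blast
  have int: "of_int D * crd (y * b) b' \<in> \<int>" if b: "b \<in> B" "b' \<in> B" and "y \<in> Z.span F" for y b b'
    using that(3)
  proof (induction y rule: Z.span_induct_alt)
    case base
    show ?case by (simp add: crd_zero)
  next
    case (step c f y)
    have f: "of_int D * crd (f * b) b' \<in> \<int>" using D(2) step(1) b by (force simp: A_def)
    have split: "(of_int c * f + y) * b = of_int c * (f * b) + y * b" by (simp add: algebra_simps)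
    have "of_int D * crd ((of_int c * f + y) * b) b' =
        of_int c * (of_int D * crd (f * b) b') + of_int D * crd (y * b) b'"
      unfolding split crd_add crd_of_int by (simp only: distrib_left mult.left_commute)
    moreover have "\<dots> \<in> \<int>" by (intro Ints_add Ints_mult Ints_of_int f step(2))
    ultimately show ?case by (rule ssubst)
  qed
  define P where "P = (\<Prod>\<sigma>\<in>embeddings. cmod (\<sigma> x))"
  assume "\<not> 1 \<le> (\<Prod>\<sigma>\<in>embeddings. cmod (\<sigma> x))"
  then have P: "P < 1" by (simp add: P_def)
  have P0: "0 \<le> P" by (simp add: P_def prod_nonneg)
  have "1 \<le> real_of_int D ^ card B * P ^ k" for k
  proof -
    have "1 \<le> real_of_int D ^ card B * (\<Prod>\<sigma>\<in>embeddings. cmod (\<sigma> (x ^ k)))"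
      using x D(1) int F(2) by (intro norm_lower_bound_denominator) auto
    also have "(\<Prod>\<sigma>\<in>embeddings. cmod (\<sigma> (x ^ k))) = P ^ k"
      unfolding P_def prod_power_distrib
      by (intro prod.cong) (auto simp: embeddings_def embedding_power norm_power)
    finally show ?thesis .
  qed
  moreover have "(\<lambda>k. real_of_int D ^ card B * P ^ k) \<longlonglongrightarrow> real_of_int D ^ card B * 0"
    using P P0 by (intro tendsto_mult_left LIMSEQ_realpow_zero)
  ultimately have "1 \<le> real_of_int D ^ card B * 0" by (intro LIMSEQ_le_const) auto
  then show False by simp
qed

end

section \<open>Finitely generated modules stable under algebraic integers\<close>

lemma algebraic_int_power_in_span:
  fixes z :: "'a::field_char_0"
  assumes "algebraic_int z"
  shows "\<exists>n>0. z ^ n \<in> Z.span ((\<lambda>i. z ^ i) ` {..<n})"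
proof -
  obtain p :: "int poly" where p: "poly (map_poly of_int p) z = 0" "lead_coeff p = 1"
    using assms by (auto simp: algebraic_int_altdef_ipoly)
  define n where "n = degree p"
  have deg: "degree (map_poly of_int p :: 'a poly) = n" unfolding n_def by (rule degree_map_poly) simp
  have "(\<Sum>i\<le>n. of_int (coeff p i) * z ^ i) = 0" using p(1) by (simp add: poly_altdef deg coeff_map_poly)
  then have "(\<Sum>i<n. of_int (coeff p i) * z ^ i) + z ^ n = 0"
    using p(2) by (simp add: lessThan_Suc_atMost[symmetric] n_def)
  then have zn: "z ^ n = - (\<Sum>i<n. of_int (coeff p i) * z ^ i)" by (simp add: eq_neg_iff_add_eq_0 add.commute)
  \<comment> \<open>A constant monic polynomial would give 1 = 0. Positivity of \<open>n\<close>
    later keeps 1 among the generators of the common module.\<close>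
  have "n > 0"
  proof (rule ccontr)
    assume "\<not> n > 0"
    then show False using zn by simp
  qed
  moreover have "z ^ n \<in> Z.span ((\<lambda>i. z ^ i) ` {..<n})"
    unfolding zn by (intro Z.span_neg Z.span_sum Z.span_scale Z.span_base) auto
  ultimately show ?thesis by blast
qed

lemma mult_in_int_span:
  fixes y :: "'a::comm_ring_1"
  assumes "a \<in> Z.span A" "\<And>a. a \<in> A \<Longrightarrow> y * a \<in> Z.span G"
  shows "y * a \<in> Z.span G"
  using assms(1)
proof (induction a rule: Z.span_induct_alt)
  case base
  show ?case by (simp add: Z.span_zero)
next
  case (step c b a)
  have "y * (of_int c * b + a) = of_int c * (y * b) + y * a" by (simp add: algebra_simps)
  then show ?case using step assms(2) by (simp add: Z.span_add Z.span_scale)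
qed

text \<open>The generators for the smaller set are multiplied by the powers of \<open>z\<close>
  below the degree of an integral equation; the next power is reduced by that equation.\<close>

lemma algebraic_ints_common_module:
  fixes Z :: "'a::field_char_0 set"
  assumes "finite Z" "\<forall>z\<in>Z. algebraic_int z"
  shows "\<exists>F. finite F \<and> 1 \<in> F \<and> (\<forall>z\<in>Z. \<forall>f\<in>F. z * f \<in> Z.span F)"
  using assms
proof (induction Z rule: finite_induct)
  case empty
  show ?case by (intro exI[of _ "{1}"]) simp
next
  case (insert z Z)
  then obtain F where F: "finite F" "1 \<in> F" "\<And>z f. z \<in> Z \<Longrightarrow> f \<in> F \<Longrightarrow> z * f \<in> Z.span F" by auto
  obtain n where n: "0 < n" "z ^ n \<in> Z.span ((\<lambda>i. z ^ i) ` {..<n})"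
    using algebraic_int_power_in_span[of z] insert.prems by auto
  define G where "G = (\<lambda>(f, i). f * z ^ i) ` (F \<times> {..<n})"
  have G: "f * z ^ i \<in> G" if "f \<in> F" "i < n" for f i using that by (auto simp: G_def)
  have zG: "z * (f * z ^ i) \<in> Z.span G" if f: "f \<in> F" and i: "i < n" for f i
  proof (cases "Suc i < n")
    case True
    have "z * (f * z ^ i) = f * z ^ Suc i" by (simp add: mult_ac)
    then show ?thesis using G[OF f True] by (metis Z.span_base)
  next
    case False
    then have "Suc i = n" using i by simp
    then have "z * (f * z ^ i) = f * z ^ n" by (metis mult.left_commute power_Suc)
    moreover have "f * z ^ n \<in> Z.span G"
      by (rule mult_in_int_span[OF n(2)]) (auto intro!: Z.span_base G f)
    ultimately show ?thesis by (rule ssubst)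
  qed
  have wG: "w * (f * z ^ i) \<in> Z.span G" if w: "w \<in> Z" and f: "f \<in> F" and i: "i < n" for w f i
  proof -
    have "z ^ i * (w * f) \<in> Z.span G"
      by (rule mult_in_int_span[OF F(3)[OF w f]]) (auto intro!: Z.span_base simp: mult.commute[of "z ^ i"] G i)
    then show ?thesis by (simp add: mult_ac)
  qed
  have "1 \<in> G" using G[OF F(2) n(1)] by simp
  moreover have "finite G" using F(1) by (simp add: G_def)
  moreover have "\<forall>w\<in>insert z Z. \<forall>f\<in>G. w * f \<in> Z.span G" using zG wG by (auto simp: G_def)
  ultimately show ?case by blast
qed

lemma number_field_basis:
  assumes "number_field TYPE('k::field_char_0)"
  shows "\<exists>B :: 'k set. numfield B"
proof -
  obtain B0 :: "'k set" where B0: "finite B0" "Q.span B0 = UNIV" using assms by (auto simp: number_field_def)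
  obtain B where B: "B \<subseteq> B0" "Q.independent B" "B0 \<subseteq> Q.span B"
    by (rule Q.maximal_independent_subset)
  have "Q.span B = UNIV" using B0(2) Q.span_minimal[OF B(3) Q.subspace_span] by auto
  then have "numfield B" unfolding numfield_def using B(2) finite_subset[OF B(1) B0(1)] by (intro conjI)
  then show ?thesis ..
qed

text \<open>Stability of the module under the four algebraic integers passes to the determinant, and
  since 1 is a generator, all powers of the determinant lie in this one finitely generated
  module.\<close>

lemma norm_lower_bound_det:
  fixes p q p' q' :: "'k::field_char_0"
  assumes K: "number_field TYPE('k)"
    and int: "algebraic_int p" "algebraic_int q" "algebraic_int p'" "algebraic_int q'"
    and ne: "p * q' - p' * q \<noteq> 0"
  shows "1 \<le> (\<Prod>\<sigma>\<in>embeddings. cmod (\<sigma> (p * q' - p' * q)))"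
proof -
  obtain B :: "'k set" where "numfield B" using number_field_basis[OF K] by blast
  then interpret numfield B .
  obtain F where F: "finite F" "1 \<in> F" "\<And>z f. z \<in> {p, q, p', q'} \<Longrightarrow> f \<in> F \<Longrightarrow> z * f \<in> Z.span F"
    using algebraic_ints_common_module[of "{p, q, p', q'}"] int by blast
  have closed: "z * a \<in> Z.span F" if "z \<in> {p, q, p', q'}" "a \<in> Z.span F" for z a
    by (rule mult_in_int_span[OF that(2) F(3)[OF that(1)]])
  have "(p * q' - p' * q) * a \<in> Z.span F" if "a \<in> Z.span F" for a
  proof -
    have "p * (q' * a) - p' * (q * a) \<in> Z.span F" using that by (intro Z.span_diff closed) auto
    then show ?thesis by (simp add: algebra_simps)
  qed
  then have "(p * q' - p' * q) ^ k \<in> Z.span F" for k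
    by (induction k) (auto intro: Z.span_base F)
  then show ?thesis by (rule norm_lower_bound_powers[OF ne F(1)])
qed

section \<open>Nearby approximations are proportional\<close>

text \<open>The local degree of a place, equal to the number of embeddings that a member of
  \<open>S\<close> stands for.\<close>

definition embedding_weight :: "('k::field_char_0 \<Rightarrow> complex) \<Rightarrow> nat" where
  "embedding_weight \<sigma> = (if real_embedding \<sigma> then 1 else 2)"

text \<open>For \<open>A = S\<close> this is the second maximum in the definition of
  \<open>Bad\<close>.\<close>

definition max_abs :: "('k \<Rightarrow> complex) set \<Rightarrow> 'k \<Rightarrow> real" where
  "max_abs A q = Max ((\<lambda>\<sigma>. cmod (\<sigma> q)) ` A)"

lemma cmod_le_max_abs: "finite A \<Longrightarrow> \<sigma> \<in> A \<Longrightarrow> cmod (\<sigma> q) \<le> max_abs A q"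
  by (simp add: max_abs_def)

lemma max_abs_attained:
  assumes "finite A" "A \<noteq> {}"
  shows "\<exists>\<sigma>\<in>A. cmod (\<sigma> q) = max_abs A q"
proof -
  have "max_abs A q \<in> (\<lambda>\<sigma>. cmod (\<sigma> q)) ` A"
    unfolding max_abs_def using assms by (intro Max_in) auto
  then show ?thesis by auto
qed

lemma prod_power_le_power_sum:
  fixes f :: "'b \<Rightarrow> real"
  assumes "\<And>x. x \<in> A \<Longrightarrow> 0 \<le> f x" "\<And>x. x \<in> A \<Longrightarrow> f x \<le> u"
  shows "(\<Prod>x\<in>A. f x ^ w x) \<le> u ^ (\<Sum>x\<in>A. w x)"
proof -
  have "(\<Prod>x\<in>A. f x ^ w x) \<le> (\<Prod>x\<in>A. u ^ w x)"
    using assms by (intro prod_mono) (auto intro: power_mono)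
  then show ?thesis by (simp add: power_sum)
qed

text \<open>The powers of \<open>Y\<close> off \<open>A\<close> are absorbed by those on
  \<open>A\<close>, where the total weight is at least as large; the surviving factor is a positive
  power of \<epsilon>.\<close>

lemma weighted_prod_less_one:
  fixes f :: "'b \<Rightarrow> real"
  assumes S: "finite S" "A \<subseteq> S" and w: "sum w (S - A) \<le> sum w A" "0 < sum w A"
    and e: "0 < \<epsilon>" "\<epsilon> < 1" and Y: "1 \<le> Y" and f0: "\<And>x. x \<in> S \<Longrightarrow> 0 \<le> f x"
    and f: "\<And>x. x \<in> A \<Longrightarrow> f x \<le> \<epsilon> / Y" "\<And>x. x \<in> S - A \<Longrightarrow> f x \<le> \<epsilon> * Y"
  shows "(\<Prod>x\<in>S. f x ^ w x) < 1"
proof -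
  have "(\<Prod>x\<in>S. f x ^ w x) = (\<Prod>x\<in>S - A. f x ^ w x) * (\<Prod>x\<in>A. f x ^ w x)"
    by (rule prod.subset_diff[OF S(2,1)])
  also have "\<dots> \<le> (\<epsilon> * Y) ^ sum w (S - A) * (\<epsilon> / Y) ^ sum w A"
    using e Y f0 f S(2) by (intro mult_mono prod_power_le_power_sum prod_nonneg) auto
  also have "\<dots> \<le> (1 * Y) ^ sum w (S - A) * (\<epsilon> / Y) ^ sum w A"
    using e Y by (intro mult_right_mono power_mono) auto
  also have "\<dots> \<le> Y ^ sum w A * (\<epsilon> / Y) ^ sum w A"
    using e Y w(1) by (intro mult_right_mono) (auto intro: power_increasing)
  also have "\<dots> = \<epsilon> ^ sum w A" using Y by (simp flip: power_mult_distrib)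
  also have "\<dots> < 1" using e w(2) by (auto intro: power_less_one_iff[THEN iffD2])
  finally show ?thesis .
qed

section \<open>Places, conjugation and local degrees\<close>

locale represented_numfield =
  fixes S :: "('k::field_char_0 \<Rightarrow> complex) set"
  assumes number_field: "number_field TYPE('k)" and representatives: "embedding_representatives S"
begin

lemma finite_all_embeddings: "finite (embeddings :: ('k \<Rightarrow> complex) set)"
  and card_all_embeddings: "card (embeddings :: ('k \<Rightarrow> complex) set) = field_degree TYPE('k)"
proof -
  obtain B :: "'k set" where "numfield B" using number_field_basis[OF number_field] by blast
  then interpret numfield B .
  show "finite (embeddings :: ('k \<Rightarrow> complex) set)" by (rule finite_embeddings)
  show "card (embeddings :: ('k \<Rightarrow> complex) set) = field_degree TYPE('k)"
    by (simp add: card_embeddings field_degree_eq)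
qed

lemma S_embedding: "\<sigma> \<in> S \<Longrightarrow> field_embedding \<sigma>"
  using representatives by (simp add: embedding_representatives_def)

lemma finite_S: "finite S"
  using finite_all_embeddings by (rule finite_subset[rotated]) (auto simp: embeddings_def S_embedding)

definition cnj_embedding :: "('k \<Rightarrow> complex) \<Rightarrow> 'k \<Rightarrow> complex" where "cnj_embedding \<sigma> = (\<lambda>x. cnj (\<sigma> x))"

lemma cnj_embedding_cnj_embedding: "cnj_embedding (cnj_embedding \<sigma>) = \<sigma>"
  by (simp add: cnj_embedding_def)

lemma inj_cnj_embedding: "inj cnj_embedding"
  by (metis cnj_embedding_cnj_embedding injI)

lemma field_embedding_cnj: "field_embedding \<sigma> \<Longrightarrow> field_embedding (cnj_embedding \<sigma>)"
  by (auto simp: field_embedding_def cnj_embedding_def)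

lemma cnj_embedding_eq_iff_real: "field_embedding \<sigma> \<Longrightarrow> cnj_embedding \<sigma> = \<sigma> \<longleftrightarrow> real_embedding \<sigma>"
  by (simp add: cnj_embedding_def real_embedding_def fun_eq_iff Reals_cnj_iff image_subset_iff)

definition nonreal :: "('k \<Rightarrow> complex) set" where "nonreal = {\<sigma> \<in> S. \<not> real_embedding \<sigma>}"

text \<open>If \<sigma> and its conjugate were both in \<open>S\<close>, both would be the unique
  representative of \<sigma>, which forces \<sigma> to be real.\<close>

lemma embeddings_decomposition: "embeddings = S \<union> cnj_embedding ` nonreal" "S \<inter> cnj_embedding ` nonreal = {}"
proof -
  have ex1: "\<exists>!\<sigma>. \<sigma> \<in> S \<and> (\<sigma> = \<tau> \<or> \<sigma> = cnj_embedding \<tau>)" if "field_embedding \<tau>" for \<tau>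
    using representatives that by (simp add: embedding_representatives_def cnj_embedding_def)
  show "embeddings = S \<union> cnj_embedding ` nonreal"
  proof
    show "S \<union> cnj_embedding ` nonreal \<subseteq> embeddings"
      by (auto simp: embeddings_def nonreal_def S_embedding field_embedding_cnj)
    show "embeddings \<subseteq> S \<union> cnj_embedding ` nonreal"
    proof
      fix \<tau> :: "'k \<Rightarrow> complex" assume "\<tau> \<in> embeddings"
      then have \<tau>: "field_embedding \<tau>" by (simp add: embeddings_def)
      then obtain \<sigma> where \<sigma>: "\<sigma> \<in> S" "\<sigma> = \<tau> \<or> \<sigma> = cnj_embedding \<tau>" using ex1 by blast
      then have eq: "\<tau> = \<sigma> \<or> \<tau> = cnj_embedding \<sigma>" using cnj_embedding_cnj_embedding by metis
      show "\<tau> \<in> S \<union> cnj_embedding ` nonreal"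
      proof (cases "real_embedding \<sigma>")
        case True
        then have "cnj_embedding \<sigma> = \<sigma>" using cnj_embedding_eq_iff_real S_embedding[OF \<sigma>(1)] by blast
        then show ?thesis using eq \<sigma>(1) by auto
      next
        case False
        then show ?thesis using eq \<sigma>(1) by (auto simp: nonreal_def)
      qed
    qed
  qed
  show "S \<inter> cnj_embedding ` nonreal = {}"
  proof (rule ccontr)
    assume "S \<inter> cnj_embedding ` nonreal \<noteq> {}"
    then obtain \<sigma> where \<sigma>: "\<sigma> \<in> S" "\<not> real_embedding \<sigma>" "cnj_embedding \<sigma> \<in> S" by (auto simp: nonreal_def)
    then have "cnj_embedding \<sigma> = \<sigma>" using ex1[OF S_embedding[OF \<sigma>(1)]] by blast
    then show False using cnj_embedding_eq_iff_real[OF S_embedding[OF \<sigma>(1)]] \<sigma>(2) by blast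
  qed
qed

lemma sum_weight_S: "sum embedding_weight S = field_degree TYPE('k)"
proof -
  have "field_degree TYPE('k) = card S + card (cnj_embedding ` nonreal)"
    using embeddings_decomposition finite_S card_Un_disjoint[of S "cnj_embedding ` nonreal"]
    by (simp add: nonreal_def flip: card_all_embeddings)
  also have "card (cnj_embedding ` nonreal) = card nonreal"
    using inj_cnj_embedding by (intro card_image) (auto intro: inj_on_subset)
  also have "card S + card nonreal = (\<Sum>\<sigma>\<in>S. 1) + (\<Sum>\<sigma>\<in>S. if real_embedding \<sigma> then 0 else 1)"
    using finite_S by (simp add: nonreal_def sum.If_cases Int_def)
  also have "\<dots> = sum embedding_weight S"
    unfolding sum.distrib[symmetric] by (intro sum.cong) (auto simp: embedding_weight_def)
  finally show ?thesis by simp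
qed

text \<open>Conjugate embeddings have equal absolute values, so each nonreal member of
  \<open>S\<close> contributes the square of its absolute value to the norm.\<close>

lemma prod_S: "(\<Prod>\<sigma>\<in>S. cmod (\<sigma> x) ^ embedding_weight \<sigma>) = (\<Prod>\<sigma>\<in>embeddings. cmod (\<sigma> x))"
proof -
  have "(\<Prod>\<sigma>\<in>embeddings. cmod (\<sigma> x)) = (\<Prod>\<sigma>\<in>S. cmod (\<sigma> x)) * (\<Prod>\<sigma>\<in>cnj_embedding ` nonreal. cmod (\<sigma> x))"
    unfolding embeddings_decomposition(1)
    using finite_S embeddings_decomposition(2) by (intro prod.union_disjoint) (auto simp: nonreal_def)
  also have "(\<Prod>\<sigma>\<in>cnj_embedding ` nonreal. cmod (\<sigma> x)) = (\<Prod>\<sigma>\<in>nonreal. cmod (\<sigma> x))"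
    using inj_cnj_embedding by (subst prod.reindex) (auto intro: inj_on_subset simp: cnj_embedding_def)
  also have "\<dots> = (\<Prod>\<sigma>\<in>S. if real_embedding \<sigma> then 1 else cmod (\<sigma> x))"
    using finite_S by (simp add: nonreal_def prod.If_cases Int_def)
  also have "(\<Prod>\<sigma>\<in>S. cmod (\<sigma> x)) * \<dots> = (\<Prod>\<sigma>\<in>S. cmod (\<sigma> x) ^ embedding_weight \<sigma>)"
    unfolding prod.distrib[symmetric] by (intro prod.cong) (auto simp: embedding_weight_def power2_eq_square)
  finally show ?thesis by simp
qed

lemma weighted_card_eq_sum:
  assumes "A \<subseteq> S"
  shows "card {\<sigma> \<in> A. real_embedding \<sigma>} + 2 * card {\<sigma> \<in> A. complex_embedding \<sigma>} = sum embedding_weight A"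
proof -
  have fin: "finite A" using assms finite_S finite_subset by blast
  have "{\<sigma> \<in> A. complex_embedding \<sigma>} = {\<sigma> \<in> A. \<not> real_embedding \<sigma>}"
    using assms S_embedding by (auto simp: complex_embedding_def real_embedding_def)
  then show ?thesis using fin
    by (simp add: embedding_weight_def sum.If_cases Int_def)
qed

lemma norm_ge_1:
  assumes "algebraic_int p" "algebraic_int q" "algebraic_int p'" "algebraic_int q'" "p * q' - p' * q \<noteq> 0"
  shows "1 \<le> (\<Prod>\<sigma>\<in>S. cmod (\<sigma> (p * q' - p' * q)) ^ embedding_weight \<sigma>)"
  unfolding prod_S by (rule norm_lower_bound_det[OF number_field assms])

end

text \<open>\<open>A\<close> is the set of places at which the derivative of the curve is known not to vanish.\<close>

locale active_places = represented_numfield S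
  for S :: "('k::field_char_0 \<Rightarrow> complex) set" +
  fixes A :: "('k \<Rightarrow> complex) set"
  assumes A_subset: "A \<subseteq> S" and A_weight: "field_degree TYPE('k) div 2 < sum embedding_weight A"
begin

section \<open>Denominator sizes on places of majority weight\<close>

lemma finite_A: "finite A"
  using A_subset finite_S finite_subset by blast

lemma A_nonempty: "A \<noteq> {}"
  using A_weight by auto

text \<open>Exceeding \<open>d div 2\<close> means carrying more than half of the degree
  \<open>d\<close>, for odd \<open>d\<close> as well.\<close>

lemma complement_weight: "sum embedding_weight (S - A) \<le> sum embedding_weight A"
proof -
  have "sum embedding_weight S = sum embedding_weight (S - A) + sum embedding_weight A"
    by (rule sum.subset_diff[OF A_subset finite_S])
  then show ?thesis using A_weight sum_weight_S by linarith
qed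

lemma max_abs_mono: "max_abs A q \<le> max_abs S q"
  using max_abs_attained[OF finite_A A_nonempty, of q] A_subset cmod_le_max_abs[OF finite_S, of _ q]
  by (metis subsetD)

lemma max_abs_nonneg: "0 \<le> max_abs A q"
  using max_abs_attained[OF finite_A A_nonempty, of q] by (metis norm_ge_zero)

lemma max_abs_S_ge_1:
  assumes q: "algebraic_int q" "q \<noteq> 0"
  shows "1 \<le> max_abs S q"
proof (rule ccontr)
  assume "\<not> 1 \<le> max_abs S q"
  then have lt: "max_abs S q < 1" by simp
  \<comment> \<open>The norm of \<open>q\<close> appears as that of a determinant with the rows 1, 0
    and 0, \<open>q\<close>.\<close>
  have "1 \<le> (\<Prod>\<sigma>\<in>S. cmod (\<sigma> q) ^ embedding_weight \<sigma>)"
    using norm_ge_1[of 1 0 0 q] q by simp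
  also have "\<dots> \<le> max_abs S q ^ sum embedding_weight S"
    by (intro prod_power_le_power_sum cmod_le_max_abs finite_S) auto
  also have "sum embedding_weight A \<le> sum embedding_weight S"
    using A_subset finite_S by (intro sum_mono2) auto
  then have "max_abs S q ^ sum embedding_weight S < 1"
    using lt A_weight max_abs_nonneg[of q] max_abs_mono[of q]
    by (intro power_less_one_iff[THEN iffD2]) auto
  finally show False by simp
qed

text \<open>The norm is at least 1 and at most \<open>max_abs S q\<close> to the weight off
  \<open>A\<close> times \<open>max_abs A q\<close> to the weight of \<open>A\<close>. Since
  \<open>max_abs S q\<close> is at least 1, the first exponent may be raised to the second.\<close>

lemma max_abs_product_ge_1:
  assumes q: "algebraic_int q" "q \<noteq> 0"
  shows "1 \<le> max_abs S q * max_abs A q"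
proof (rule ccontr)
  assume "\<not> 1 \<le> max_abs S q * max_abs A q"
  then have lt: "max_abs S q * max_abs A q < 1" by simp
  let ?w = "sum embedding_weight A"
  have "1 \<le> (\<Prod>\<sigma>\<in>S. cmod (\<sigma> q) ^ embedding_weight \<sigma>)"
    using norm_ge_1[of 1 0 0 q] q by simp
  also have "\<dots> = (\<Prod>\<sigma>\<in>S - A. cmod (\<sigma> q) ^ embedding_weight \<sigma>) * (\<Prod>\<sigma>\<in>A. cmod (\<sigma> q) ^ embedding_weight \<sigma>)"
    by (rule prod.subset_diff[OF A_subset finite_S])
  also have "\<dots> \<le> max_abs S q ^ sum embedding_weight (S - A) * max_abs A q ^ ?w"
    using max_abs_S_ge_1[OF q]
    by (intro mult_mono prod_power_le_power_sum prod_nonneg) (auto intro: cmod_le_max_abs finite_S finite_A)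
  also have "\<dots> \<le> max_abs S q ^ ?w * max_abs A q ^ ?w"
    using max_abs_S_ge_1[OF q] complement_weight max_abs_nonneg
    by (intro mult_right_mono power_increasing) auto
  also have "\<dots> = (max_abs S q * max_abs A q) ^ ?w" by (simp add: power_mult_distrib)
  also have "\<dots> < 1" using lt A_weight max_abs_nonneg[of q] max_abs_S_ge_1[OF q]
    by (intro power_less_one_iff[THEN iffD2]) auto
  finally show False by simp
qed

text \<open>The quantity \<open>Y = H q * H q' * r / \<kappa>\<close> measures how unbalanced the denominators are:
  the conjugates of the determinant are at most \<open>\<epsilon> / Y\<close> on \<open>A\<close> and \<open>\<epsilon> * Y\<close> elsewhere, and
  since \<open>A\<close> carries at least half of the total weight, the norm is less than 1.\<close>

lemma close_approximations_proportional:
  assumes int: "algebraic_int p" "algebraic_int q" "algebraic_int p'" "algebraic_int q'"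
    and q0: "q \<noteq> 0" "q' \<noteq> 0"
    and r: "0 < r" and T: "0 < T" "T \<le> 1" and \<kappa>: "0 < \<kappa>" and c: "0 < c" and L: "0 \<le> L"
    and small: "2 * c / T + 2 * L * \<kappa> / T\<^sup>2 < 1"
    and H: "\<kappa> / r \<le> max_abs S q * max_abs A q" "max_abs S q * max_abs A q < \<kappa> / (T * r)"
    and H': "\<kappa> / r \<le> max_abs S q' * max_abs A q'" "max_abs S q' * max_abs A q' < \<kappa> / (T * r)"
    and u: "\<And>\<sigma>. \<sigma> \<in> S \<Longrightarrow> cmod (\<sigma> p + v \<sigma> * \<sigma> q) \<le> c / max_abs S q"
    and u': "\<And>\<sigma>. \<sigma> \<in> S \<Longrightarrow> cmod (\<sigma> p' + v' \<sigma> * \<sigma> q') \<le> c / max_abs S q'"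
    and vv: "\<And>\<sigma>. \<sigma> \<in> S \<Longrightarrow> cmod (v \<sigma> - v' \<sigma>) \<le> 2 * L * r"
  shows "p * q' = p' * q"
proof (rule ccontr)
  define h h' m m' where "h = max_abs S q" and "h' = max_abs S q'" and "m = max_abs A q" and "m' = max_abs A q'"
  define \<epsilon> where "\<epsilon> = 2 * c / T + 2 * L * \<kappa> / T\<^sup>2"
  define Y where "Y = h * h' * r / \<kappa>"
  define \<Delta> where "\<Delta> = p * q' - p' * q"
  have h: "1 \<le> h" "1 \<le> h'" unfolding h_def h'_def using max_abs_S_ge_1 int q0 by auto
  have m: "0 \<le> m" "0 \<le> m'" "m \<le> h" "m' \<le> h'"
    unfolding m_def m'_def h_def h'_def using max_abs_nonneg max_abs_mono by auto
  have hm: "\<kappa> / r \<le> h * m" "h * m < \<kappa> / (T * r)" "\<kappa> / r \<le> h' * m'" "h' * m' < \<kappa> / (T * r)"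
    using H H' by (simp_all add: h_def h'_def m_def m'_def)
  have hh: "\<kappa> / r \<le> h\<^sup>2" "\<kappa> / r \<le> h'\<^sup>2"
  proof -
    have "h * m \<le> h * h" "h' * m' \<le> h' * h'" using m h by (auto intro: mult_left_mono)
    then show "\<kappa> / r \<le> h\<^sup>2" "\<kappa> / r \<le> h'\<^sup>2" using hm(1,3) by (auto simp: power2_eq_square)
  qed
  have \<epsilon>: "0 < \<epsilon>" "\<epsilon> < 1" using small T c L \<kappa> by (auto simp: \<epsilon>_def intro!: add_pos_nonneg)
  \<comment> \<open>Both heights satisfy \<open>\<kappa> / r \<le> h\<^sup>2\<close>, because
    \<open>m \<le> h\<close>; multiply the two bounds and take square roots.\<close>
  have Y: "1 \<le> Y"
  proof -
    have "(\<kappa> / r)\<^sup>2 \<le> h\<^sup>2 * h'\<^sup>2" unfolding power2_eq_square[of "\<kappa> / r"]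
      using hh r \<kappa> by (intro mult_mono) auto
    then have "(\<kappa> / r)\<^sup>2 \<le> (h * h')\<^sup>2" by (simp add: power_mult_distrib)
    then have "\<kappa> / r \<le> h * h'" by (rule power2_le_imp_le) (use h in auto)
    then show ?thesis using r \<kappa> by (simp add: Y_def field_simps)
  qed
  have bound: "cmod (\<sigma> \<Delta>) \<le> c / h * cmod (\<sigma> q') + c / h' * cmod (\<sigma> q) + 2 * L * r * cmod (\<sigma> q) * cmod (\<sigma> q')"
    if \<sigma>: "\<sigma> \<in> S" for \<sigma>
  proof -
    \<comment> \<open>The products with \<open>v \<sigma>\<close> and \<open>v' \<sigma>\<close> are
      inserted so that only the two approximation errors and the variation of the curve
      remain.\<close>
    have "\<sigma> \<Delta> = (\<sigma> p + v \<sigma> * \<sigma> q) * \<sigma> q' - (\<sigma> p' + v' \<sigma> * \<sigma> q') * \<sigma> q - (v \<sigma> - v' \<sigma>) * (\<sigma> q * \<sigma> q')"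
      using S_embedding[OF \<sigma>] by (simp add: \<Delta>_def embedding_diff embedding_mult algebra_simps)
    also have "cmod \<dots> \<le> cmod ((\<sigma> p + v \<sigma> * \<sigma> q) * \<sigma> q') + cmod ((\<sigma> p' + v' \<sigma> * \<sigma> q') * \<sigma> q) + cmod ((v \<sigma> - v' \<sigma>) * (\<sigma> q * \<sigma> q'))"
      by (intro order_trans[OF norm_triangle_ineq4] add_mono norm_triangle_ineq4 order_refl)
    also have "\<dots> \<le> c / h * cmod (\<sigma> q') + c / h' * cmod (\<sigma> q) + 2 * L * r * (cmod (\<sigma> q) * cmod (\<sigma> q'))"
      unfolding norm_mult using u[OF \<sigma>] u'[OF \<sigma>] vv[OF \<sigma>]
      by (intro add_mono mult_right_mono) (auto simp: h_def h'_def)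
    finally show ?thesis by (simp add: mult.assoc)
  qed
  have h0: "h \<noteq> 0" "h' \<noteq> 0" and nz: "r \<noteq> 0" "T \<noteq> 0" "\<kappa> \<noteq> 0" using h r T \<kappa> by auto
  have mono: "c / h * x' + c / h' * x + 2 * L * r * x * x' \<le> c / h * y' + c / h' * y + 2 * L * r * y * y'"
    if "0 \<le> x" "x \<le> y" "0 \<le> x'" "x' \<le> y'" for x x' y y'
  proof -
    have "0 \<le> y" "0 \<le> y'" using that by auto
    then show ?thesis using that c h L r by (intro add_mono mult_mono) auto
  qed
  have on_A: "cmod (\<sigma> \<Delta>) \<le> \<epsilon> / Y" if \<sigma>: "\<sigma> \<in> A" for \<sigma>
  proof -
    have q: "cmod (\<sigma> q) \<le> m" "cmod (\<sigma> q') \<le> m'"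
      unfolding m_def m'_def using \<sigma> by (auto intro: cmod_le_max_abs finite_A)
    have "cmod (\<sigma> \<Delta>) \<le> c / h * m' + c / h' * m + 2 * L * r * m * m'"
      by (rule order_trans[OF bound mono]) (use q \<sigma> A_subset in auto)
    \<comment> \<open>Over the denominator \<open>h * h'\<close> only the products
      \<open>h * m\<close> and \<open>h' * m'\<close> remain, and these have upper bounds.\<close>
    also have "\<dots> = (c * (h' * m') + c * (h * m) + 2 * L * r * ((h * m) * (h' * m'))) / (h * h')"
      using h0 by (simp add: field_simps)
    also have "\<dots> \<le> (c * (\<kappa> / (T * r)) + c * (\<kappa> / (T * r)) + 2 * L * r * ((\<kappa> / (T * r)) * (\<kappa> / (T * r)))) / (h * h')"
      using hm h m c L r \<kappa> T by (intro divide_right_mono add_mono mult_left_mono mult_mono) auto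
    also have "\<dots> = \<epsilon> / Y"
      using nz h0 by (simp add: \<epsilon>_def Y_def field_simps power2_eq_square)
    finally show ?thesis .
  qed
  have off_A: "cmod (\<sigma> \<Delta>) \<le> \<epsilon> * Y" if \<sigma>: "\<sigma> \<in> S - A" for \<sigma>
  proof -
    have q: "cmod (\<sigma> q) \<le> h" "cmod (\<sigma> q') \<le> h'"
      unfolding h_def h'_def using \<sigma> by (auto intro: cmod_le_max_abs finite_S)
    \<comment> \<open>\<open>h' / h \<le> Y\<close> is \<open>\<kappa> / r \<le> h\<^sup>2\<close>
      rearranged, and symmetrically for the other quotient.\<close>
    have div: "h' / h \<le> Y" "h / h' \<le> Y"
    proof -
      have "0 \<le> h' / h" "0 \<le> h / h'" using h by auto
      then have "h' / h * (\<kappa> / r) \<le> h' / h * h\<^sup>2" "h / h' * (\<kappa> / r) \<le> h / h' * h'\<^sup>2"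
        using hh by (simp_all only: mult_left_mono)
      moreover have "h' / h * h\<^sup>2 = h * h'" "h / h' * h'\<^sup>2 = h * h'"
        using h0 by (simp_all add: power2_eq_square)
      moreover have "0 < \<kappa> / r" "Y = h * h' / (\<kappa> / r)" using \<kappa> r by (auto simp: Y_def)
      ultimately show "h' / h \<le> Y" "h / h' \<le> Y" by (simp_all only: pos_le_divide_eq)
    qed
    have "cmod (\<sigma> \<Delta>) \<le> c / h * h' + c / h' * h + 2 * L * r * h * h'"
      by (rule order_trans[OF bound mono]) (use q \<sigma> in auto)
    also have "\<dots> = c * (h' / h) + c * (h / h') + 2 * L * \<kappa> * Y"
      using nz by (simp add: Y_def)
    also have "\<dots> \<le> c * Y + c * Y + 2 * L * \<kappa> * Y"
      by (rule add_right_mono[OF add_mono[OF mult_left_mono mult_left_mono]]) (use div c in auto)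
    \<comment> \<open>The trivial denominators prepare the comparison with \<epsilon>, whose
      denominators \<open>T\<close> and \<open>T\<^sup>2\<close> are at most 1.\<close>
    also have "\<dots> = (2 * c / 1 + 2 * L * \<kappa> / 1) * Y" by (simp add: algebra_simps)
    also have "\<dots> \<le> \<epsilon> * Y"
      unfolding \<epsilon>_def using c L \<kappa> T Y
      by (intro mult_right_mono add_mono divide_left_mono) (auto simp: power_le_one)
    finally show ?thesis .
  qed
  assume "p * q' \<noteq> p' * q"
  then have "1 \<le> (\<Prod>\<sigma>\<in>S. cmod (\<sigma> \<Delta>) ^ embedding_weight \<sigma>)"
    unfolding \<Delta>_def by (intro norm_ge_1 int) simp
  moreover have "(\<Prod>\<sigma>\<in>S. cmod (\<sigma> \<Delta>) ^ embedding_weight \<sigma>) < 1"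
    using A_weight by (intro weighted_prod_less_one[OF finite_S A_subset complement_weight _ \<epsilon> Y] on_A off_A) auto
  ultimately show False by simp
qed

text \<open>The window from \<open>u\<close> to \<open>v\<close> is half open so that the windows
  belonging to the radii \<open>r\<close> and \<open>T * r\<close> abut.\<close>

definition dangerous :: "real set \<Rightarrow> (real \<Rightarrow> ('k \<Rightarrow> complex) \<Rightarrow> complex) \<Rightarrow> real \<Rightarrow> real \<Rightarrow> real \<Rightarrow> real set" where
  "dangerous J \<psi> c u v = {t \<in> J. \<exists>p q. algebraic_int p \<and> algebraic_int q \<and> q \<noteq> 0 \<and>
     u \<le> max_abs S q * max_abs A q \<and> max_abs S q * max_abs A q < v \<and>
     (\<forall>\<sigma>\<in>S. cmod (\<sigma> p + \<psi> t \<sigma> * \<sigma> q) \<le> c / max_abs S q)}"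

text \<open>All pairs in one window share the quotient \<open>z = - \<sigma> p / \<sigma> q\<close>.
  At a place of \<open>A\<close> where \<open>cmod (\<sigma> q)\<close> is maximal, dividing the
  error by \<open>\<sigma> q\<close> puts the curve within \<open>c * r / \<kappa>\<close> of
  \<open>z\<close>; expansion at rate \<mu> then confines the parameter to length
  \<open>2 * c * r / (\<kappa> * \<mu>)\<close>, which is at most
  \<open>\<alpha> * r\<close>.\<close>

lemma dangerous_cover:
  assumes lip: "\<And>\<sigma> s t. \<sigma> \<in> S \<Longrightarrow> s \<in> J \<Longrightarrow> t \<in> J \<Longrightarrow> cmod (\<psi> s \<sigma> - \<psi> t \<sigma>) \<le> L * \<bar>s - t\<bar>"
    and expand: "\<And>\<sigma> s t. \<sigma> \<in> A \<Longrightarrow> s \<in> J \<Longrightarrow> t \<in> J \<Longrightarrow> \<mu> * \<bar>s - t\<bar> \<le> cmod (\<psi> s \<sigma> - \<psi> t \<sigma>)"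
    and diam: "\<And>s t. s \<in> J \<Longrightarrow> t \<in> J \<Longrightarrow> \<bar>s - t\<bar> \<le> 2 * r"
    and r: "0 < r" and T: "0 < T" "T \<le> 1" and \<kappa>: "0 < \<kappa>" and c: "0 < c" and L: "0 \<le> L" and \<mu>: "0 < \<mu>"
    and small: "2 * c / T + 2 * L * \<kappa> / T\<^sup>2 < 1" "2 * c \<le> \<alpha> * \<kappa> * \<mu>"
  shows "\<exists>D. dangerous J \<psi> c (\<kappa> / r) (\<kappa> / (T * r)) \<subseteq> (\<Union>\<sigma>\<in>A. D \<sigma>) \<and>
    (\<forall>\<sigma>\<in>A. \<forall>s\<in>D \<sigma>. \<forall>t\<in>D \<sigma>. \<bar>s - t\<bar> \<le> \<alpha> * r)"
proof -
  define W where "W = (\<lambda>t p q. algebraic_int p \<and> algebraic_int q \<and> q \<noteq> 0 \<and>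
     \<kappa> / r \<le> max_abs S q * max_abs A q \<and> max_abs S q * max_abs A q < \<kappa> / (T * r) \<and>
     (\<forall>\<sigma>\<in>S. cmod (\<sigma> p + \<psi> t \<sigma> * \<sigma> q) \<le> c / max_abs S q))"
  \<comment> \<open>Parameters are sorted by a place of \<open>A\<close> at which the denominator is
    largest; the sets may overlap.\<close>
  define D where "D = (\<lambda>\<sigma>. {t \<in> J. \<exists>p q. W t p q \<and> cmod (\<sigma> q) = max_abs A q})"
  have "dangerous J \<psi> c (\<kappa> / r) (\<kappa> / (T * r)) \<subseteq> (\<Union>\<sigma>\<in>A. D \<sigma>)"
  proof
    fix t assume "t \<in> dangerous J \<psi> c (\<kappa> / r) (\<kappa> / (T * r))"
    then obtain p q where "t \<in> J" "W t p q" unfolding dangerous_def W_def by blast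
    moreover obtain \<sigma> where "\<sigma> \<in> A" "cmod (\<sigma> q) = max_abs A q"
      using max_abs_attained[OF finite_A A_nonempty] by blast
    ultimately show "t \<in> (\<Union>\<sigma>\<in>A. D \<sigma>)" unfolding D_def by blast
  qed
  moreover have "\<bar>s - t\<bar> \<le> \<alpha> * r" if \<sigma>: "\<sigma> \<in> A" and s: "s \<in> D \<sigma>" and t: "t \<in> D \<sigma>" for \<sigma> s t
  proof -
    obtain p q where s: "s \<in> J" "W s p q" "cmod (\<sigma> q) = max_abs A q" using s by (auto simp: D_def)
    obtain p' q' where t: "t \<in> J" "W t p' q'" "cmod (\<sigma> q') = max_abs A q'" using t by (auto simp: D_def)
    have \<sigma>S: "\<sigma> \<in> S" using \<sigma> A_subset by auto
    have emb: "field_embedding \<sigma>" using S_embedding[OF \<sigma>S] .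
    have q: "algebraic_int p" "algebraic_int q" "algebraic_int p'" "algebraic_int q'" "q \<noteq> 0" "q' \<noteq> 0"
      using s t by (auto simp: W_def)
    have close: "cmod (\<psi> x \<tau> - \<psi> y \<tau>) \<le> 2 * L * r" if "\<tau> \<in> S" "x \<in> J" "y \<in> J" for \<tau> x y
    proof -
      have "cmod (\<psi> x \<tau> - \<psi> y \<tau>) \<le> L * \<bar>x - y\<bar>" by (rule lip[OF that])
      also have "\<dots> \<le> L * (2 * r)" using diam[OF that(2,3)] L by (intro mult_left_mono) auto
      finally show ?thesis by simp
    qed
    have "p * q' = p' * q"
      using s(2) t(2) close[OF _ s(1) t(1)] unfolding W_def
      by (intro close_approximations_proportional[OF q r T \<kappa> c L small(1), where v = "\<psi> s" and v' = "\<psi> t"]) auto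
    then have pq: "\<sigma> p * \<sigma> q' = \<sigma> p' * \<sigma> q" by (metis embedding_mult[OF emb])
    have nz: "\<sigma> q \<noteq> 0" "\<sigma> q' \<noteq> 0" using q by (auto simp: embedding_eq_0_iff[OF emb])
    define z where "z = - \<sigma> p / \<sigma> q"
    have z': "z = - \<sigma> p' / \<sigma> q'" using pq nz by (simp add: z_def field_simps)
    have dist: "cmod (\<psi> x \<sigma> - z) \<le> c * r / \<kappa>"
      if W: "W x a b" and b: "cmod (\<sigma> b) = max_abs A b" "b \<noteq> 0" and z: "z = - \<sigma> a / \<sigma> b" for x a b
    proof -
      have b0: "\<sigma> b \<noteq> 0" using b by (simp add: embedding_eq_0_iff[OF emb])
      have H: "1 \<le> max_abs S b" using max_abs_S_ge_1 W by (simp add: W_def)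
      have "\<psi> x \<sigma> - z = (\<sigma> a + \<psi> x \<sigma> * \<sigma> b) / \<sigma> b" using b0 by (simp add: z field_simps)
      then have "cmod (\<psi> x \<sigma> - z) = cmod (\<sigma> a + \<psi> x \<sigma> * \<sigma> b) / max_abs A b"
        by (simp add: norm_divide b)
      also have "\<dots> \<le> c / max_abs S b / max_abs A b"
        using W \<sigma>S max_abs_nonneg by (intro divide_right_mono) (auto simp: W_def)
      also have "\<dots> = c / (max_abs S b * max_abs A b)" by simp
      also have "\<dots> \<le> c / (\<kappa> / r)"
      proof (rule divide_left_mono)
        show le: "\<kappa> / r \<le> max_abs S b * max_abs A b" using W by (simp add: W_def)
        have pos: "0 < \<kappa> / r" using \<kappa> r by simp
        show "0 < max_abs S b * max_abs A b * (\<kappa> / r)" by (rule mult_pos_pos[OF less_le_trans[OF pos le] pos])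
      qed (use c in simp)
      finally show ?thesis by simp
    qed
    have "\<mu> * \<bar>s - t\<bar> \<le> cmod (\<psi> s \<sigma> - \<psi> t \<sigma>)" by (rule expand[OF \<sigma> s(1) t(1)])
    also have "\<dots> = cmod ((\<psi> s \<sigma> - z) - (\<psi> t \<sigma> - z))" by simp
    also have "\<dots> \<le> cmod (\<psi> s \<sigma> - z) + cmod (\<psi> t \<sigma> - z)" by (rule norm_triangle_ineq4)
    also have "\<dots> \<le> c * r / \<kappa> + c * r / \<kappa>"
      using dist[OF s(2,3) q(5) z_def] dist[OF t(2,3) q(6) z'] by (rule add_mono)
    also have "\<dots> = 2 * c * (r / \<kappa>)" by simp
    also have "\<dots> \<le> \<alpha> * \<kappa> * \<mu> * (r / \<kappa>)" using small(2) r \<kappa> by (intro mult_right_mono) auto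
    also have "\<dots> = \<mu> * (\<alpha> * r)" using \<kappa> by simp
    finally show ?thesis using \<mu> by simp
  qed
  ultimately show ?thesis by blast
qed

end

section \<open>Winning sets have full Hausdorff dimension\<close>

text \<open>The centres form an arithmetic progression with step \<open>4 * \<gamma> * r\<close>,
  running from \<open>x\<close> towards an end of the unit interval at distance at least 1/2, where
  \<open>r \<le> 1/2\<close> leaves room.\<close>

lemma separated_subballs:
  fixes x r \<gamma> :: real and M :: nat
  assumes x: "x \<in> {0..1}" and r: "0 < r" "r \<le> 1/2" and g: "0 < \<gamma>" "4 * real M * \<gamma> \<le> 1"
  shows "\<exists>z. (\<forall>j<M. z j \<in> {0..1} \<and> ball_in {0..1} (z j) (\<gamma> * r) \<subseteq> ball_in {0..1} x r) \<and>
             (\<forall>i<M. \<forall>j<M. i \<noteq> j \<longrightarrow> 4 * \<gamma> * r \<le> \<bar>z i - z j\<bar>)"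
proof -
  define s :: real where "s = (if x \<le> 1/2 then 1 else -1)"
  define z where "z = (\<lambda>j::nat. x + s * ((4 * real j + 1) * (\<gamma> * r)))"
  have gr: "0 < \<gamma> * r" using g r by simp
  have room: "(4 * real j + 1) * (\<gamma> * r) + \<gamma> * r \<le> r" if "j < M" for j
  proof -
    have "4 * real j + 2 \<le> 4 * real M" using that by linarith
    then have "(4 * real j + 2) * \<gamma> \<le> 1" using g by (smt (verit) mult_right_mono)
    then have "(4 * real j + 2) * \<gamma> * r \<le> 1 * r" using r by (intro mult_right_mono) auto
    then show ?thesis by (simp add: algebra_simps)
  qed
  have "z j \<in> {0..1} \<and> ball_in {0..1} (z j) (\<gamma> * r) \<subseteq> ball_in {0..1} x r" if "j < M" for j
  proof
    have p: "0 < (4 * real j + 1) * (\<gamma> * r)" using gr mult_pos_pos[of "4 * real j + 1"] by simp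
    define a where "a = (4 * real j + 1) * (\<gamma> * r)"
    have a: "0 < a" "a + \<gamma> * r \<le> r" "z j = x + s * a" using p room[OF that] by (auto simp: a_def z_def)
    show "z j \<in> {0..1}" using a x r gr by (auto simp: s_def)
    have "\<bar>z j - x\<bar> + \<gamma> * r \<le> r" using a by (auto simp: s_def)
    then show "ball_in {0..1} (z j) (\<gamma> * r) \<subseteq> ball_in {0..1} x r"
      by (auto simp: ball_in_def dist_real_def)
  qed
  moreover have "4 * \<gamma> * r \<le> \<bar>z i - z j\<bar>" if "i \<noteq> j" for i j
  proof -
    have "z i - z j = s * ((real i - real j) * (4 * (\<gamma> * r)))" by (simp add: z_def algebra_simps)
    then have "\<bar>z i - z j\<bar> = \<bar>real i - real j\<bar> * (4 * (\<gamma> * r))"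
      using g r by (simp add: abs_mult s_def)
    moreover have "1 \<le> \<bar>real i - real j\<bar>" using that by linarith
    then have "1 * (4 * (\<gamma> * r)) \<le> \<bar>real i - real j\<bar> * (4 * (\<gamma> * r))"
      using gr by (intro mult_right_mono) auto
    ultimately show ?thesis by simp
  qed
  ultimately show ?thesis by blast
qed

text \<open>Player A's centres up to stage \<open>n\<close>, kept as a list since Player B's
  strategy reads all of them. Stage \<open>n\<close> depends on the first \<open>n\<close> digits
  only.\<close>

primrec history :: "('a list \<Rightarrow> nat \<Rightarrow> 'a) \<Rightarrow> 'a \<Rightarrow> (nat \<Rightarrow> nat) \<Rightarrow> nat \<Rightarrow> 'a list" where
  "history P a d 0 = [a]"
| "history P a d (Suc n) = history P a d n @ [P (history P a d n) (d n)]"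

lemma length_history: "length (history P a d n) = Suc n"
  by (induction n) auto

lemma history_eq_map: "map (\<lambda>k. last (history P a d k)) [0..<Suc n] = history P a d n"
  by (induction n) auto

lemma history_cong: "(\<And>k. k < n \<Longrightarrow> d k = d' k) \<Longrightarrow> history P a d n = history P a d' n"
  by (induction n) auto

text \<open>Player A starts with the whole interval and then, guided by an arbitrary sequence of digits,
  picks one of \<open>N\<close> well separated balls inside each ball of Player B.\<close>

lemma winning_contains_cantor_set:
  fixes W :: "real set" and N :: nat
  assumes win: "winning_strategy {0..1} \<alpha> \<beta> W f"
    and \<alpha>: "0 < \<alpha>" "\<alpha> < 1" and N: "0 < N" and \<beta>: "\<beta> = 1 / (4 * real N)"
  shows "\<exists>X. \<forall>d. (\<forall>k. d k < N) \<longrightarrow> X d \<in> W \<and>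
           (\<forall>d' n. (\<forall>k. d' k < N) \<longrightarrow> (\<forall>k<n. d k = d' k) \<longrightarrow> d n \<noteq> d' n \<longrightarrow>
              (\<alpha> * \<beta>) ^ Suc n \<le> \<bar>X d - X d'\<bar>)"
proof -
  have \<beta>0: "0 < \<beta>" "\<beta> < 1" using N by (auto simp: \<beta> field_simps)
  define \<theta> where "\<theta> = \<alpha> * \<beta>"
  have \<theta>: "0 < \<theta>" "\<theta> \<le> 1" using \<alpha> \<beta>0 by (auto simp: \<theta>_def mult_le_one)
  \<comment> \<open>The radius of Player B's ball at stage \<open>n\<close> in a game with initial
    radius 1/2.\<close>
  define R where "R = (\<lambda>n. \<alpha> * \<theta> ^ n * (1/2))"
  have R: "0 < R n" "R n \<le> 1/2" for n
  proof -
    show "0 < R n" using \<alpha> \<theta> by (simp add: R_def)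
    have "\<alpha> * \<theta> ^ n \<le> 1" using \<alpha> \<theta> by (intro mult_le_one) (auto simp: power_le_one)
    then show "R n \<le> 1/2" by (simp add: R_def)
  qed
  have "\<forall>x r. \<exists>z. x \<in> {0..1} \<and> 0 < r \<and> r \<le> 1/2 \<longrightarrow>
     (\<forall>j<N. z j \<in> {0..1} \<and> ball_in {0..1} (z j) (\<beta> * r) \<subseteq> ball_in {0..1} x r) \<and>
             (\<forall>i<N. \<forall>j<N. i \<noteq> j \<longrightarrow> 4 * \<beta> * r \<le> \<bar>z i - z j\<bar>)"
  proof (intro allI)
    fix x r :: real
    show "\<exists>z. x \<in> {0..1} \<and> 0 < r \<and> r \<le> 1/2 \<longrightarrow>
     (\<forall>j<N. z j \<in> {0..1} \<and> ball_in {0..1} (z j) (\<beta> * r) \<subseteq> ball_in {0..1} x r) \<and>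
             (\<forall>i<N. \<forall>j<N. i \<noteq> j \<longrightarrow> 4 * \<beta> * r \<le> \<bar>z i - z j\<bar>)"
      using separated_subballs[of x r \<beta> N] \<beta>0 N by (auto simp: \<beta>)
  qed
  then obtain Z where Z: "\<And>x r. x \<in> {0..1} \<and> 0 < r \<and> r \<le> 1/2 \<longrightarrow>
     (\<forall>j<N. Z x r j \<in> {0..1} \<and> ball_in {0..1} (Z x r j) (\<beta> * r) \<subseteq> ball_in {0..1} x r) \<and>
             (\<forall>i<N. \<forall>j<N. i \<noteq> j \<longrightarrow> 4 * \<beta> * r \<le> \<bar>Z x r i - Z x r j\<bar>)"
    by metis
  \<comment> \<open>The list of stage \<open>n\<close> has \<open>n + 1\<close> entries, so
    \<open>length hs - 1\<close> is the stage.\<close>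
  define h where "h = history (\<lambda>hs j. Z (f (1/2) hs) (R (length hs - 1)) j) (1/2)"
  define x where "x = (\<lambda>d n. last (h d n))"
  define y where "y = (\<lambda>d n. f (1/2) (h d n))"
  have y: "y d n = f (1/2) (map (x d) [0..<Suc n])" for d n
    unfolding y_def x_def h_def history_eq_map ..
  have x0: "x d 0 = 1/2" for d by (simp add: x_def h_def)
  have xS: "x d (Suc n) = Z (y d n) (R n) (d n)" for d n
    by (simp add: x_def h_def y_def length_history)
  have ball_A: "A_ball {0..1} \<alpha> \<beta> (1/2) (x d) (Suc n) = ball_in {0..1} (x d (Suc n)) (\<beta> * R n)" for d n
    by (simp add: A_ball_def R_def \<theta>_def mult_ac)
  have ball_B: "B_ball {0..1} \<alpha> \<beta> (1/2) (y d) n = ball_in {0..1} (y d n) (R n)" for d n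
    by (simp add: B_ball_def R_def \<theta>_def mult_ac)
  \<comment> \<open>Legality of the two players is intertwined: Player B's reply is known to be
    legal, hence a point of the interval, only once Player A's moves so far are.\<close>
  have A: "\<forall>k\<le>n. legal_A {0..1} \<alpha> \<beta> (1/2) (x d) (y d) k" if d: "\<forall>k. d k < N" for d n
  proof (induction n)
    case 0
    show ?case by (simp add: legal_A_def x0)
  next
    case (Suc n)
    then have "legal_B {0..1} \<alpha> \<beta> (1/2) (x d) (y d) n"
      using win y unfolding winning_strategy_def by (meson zero_less_divide_1_iff zero_less_numeral)
    then have "y d n \<in> {0..1}" by (simp add: legal_B_def)
    then have "legal_A {0..1} \<alpha> \<beta> (1/2) (x d) (y d) (Suc n)"
      using Z[of "y d n" "R n"] R[of n] d by (auto simp: legal_A_def ball_A ball_B xS)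
    then show ?case using Suc by (auto simp: le_Suc_eq)
  qed
  have B: "y d n \<in> {0..1}" if d: "\<forall>k. d k < N" for d n
    using A[OF d, of n] win y unfolding winning_strategy_def legal_B_def
    by (meson zero_less_divide_1_iff zero_less_numeral)
  have "\<exists>w\<in>W. (\<Inter>n. A_ball {0..1} \<alpha> \<beta> (1/2) (x d) n) = {w}" if d: "\<forall>k. d k < N" for d
    using A[OF d] win y unfolding winning_strategy_def
    by (meson order_refl zero_less_divide_1_iff zero_less_numeral)
  then obtain X where X: "\<And>d. \<forall>k. d k < N \<Longrightarrow>
      X d \<in> W \<and> (\<Inter>n. A_ball {0..1} \<alpha> \<beta> (1/2) (x d) n) = {X d}" by metis
  have "\<theta> ^ Suc n \<le> \<bar>X d - X d'\<bar>"
    if d: "\<forall>k. d k < N" and d': "\<forall>k. d' k < N" and eq: "\<forall>k<n. d k = d' k" and ne: "d n \<noteq> d' n"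
    for d d' n
  proof -
    have h: "h d n = h d' n" unfolding h_def using eq by (intro history_cong) auto
    then have y': "y d n = y d' n" by (simp add: y_def)
    have sep: "4 * \<beta> * R n \<le> \<bar>x d (Suc n) - x d' (Suc n)\<bar>"
      using Z[of "y d n" "R n"] R[of n] B[OF d, of n] d d' ne by (auto simp: xS y')
    have "X e \<in> ball_in {0..1} (x e (Suc n)) (\<beta> * R n)" if "\<forall>k. e k < N" for e
      using X[OF that] ball_A[of e n] by blast
    from this[OF d] this[OF d'] have "\<bar>x d (Suc n) - X d\<bar> \<le> \<beta> * R n" "\<bar>x d' (Suc n) - X d'\<bar> \<le> \<beta> * R n"
      by (auto simp: ball_in_def dist_real_def)
    \<comment> \<open>Centres \<open>4 * \<beta> * R n\<close> apart, less two radii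
      \<open>\<beta> * R n\<close>; the remaining \<open>2 * \<beta> * R n\<close> equals
      \<open>\<theta> ^ Suc n\<close>.\<close>
    then have "2 * \<beta> * R n \<le> \<bar>X d - X d'\<bar>" using sep by linarith
    then show ?thesis by (simp add: R_def \<theta>_def mult_ac)
  qed
  then show ?thesis using X unfolding \<theta>_def by blast
qed

section \<open>Digit expansions and the lower bound for the dimension\<close>

lemma powr_power_commute: "0 < z \<Longrightarrow> (z powr s) ^ n = (z ^ n) powr s" for z s :: real
  by (induction n) (simp_all add: powr_mult)

definition digit :: "nat \<Rightarrow> real \<Rightarrow> nat \<Rightarrow> nat" where
  "digit N t n = nat \<lfloor>t * real N ^ Suc n\<rfloor> mod N"

text \<open>The floor of \<open>t * N ^ m\<close> is the quotient by \<open>N\<close> of the floor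
  of \<open>t * N ^ Suc m\<close>, whose remainder is the digit; equal digits therefore give equal
  floors at level \<open>n\<close>.\<close>

lemma digits_agree_imp_close:
  assumes N: "0 < N" and t: "t \<in> {0..<1}" "t' \<in> {0..<1}" and eq: "\<forall>k<n. digit N t k = digit N t' k"
  shows "\<bar>t - t'\<bar> \<le> 1 / real N ^ n"
proof -
  have div: "nat \<lfloor>u * real N ^ Suc m\<rfloor> div N = nat \<lfloor>u * real N ^ m\<rfloor>" if "0 \<le> u" for u m
  proof -
    have "\<lfloor>u * real N ^ m\<rfloor> = \<lfloor>u * real N ^ Suc m / real_of_int (int N)\<rfloor>" using N by simp
    also have "\<dots> = \<lfloor>u * real N ^ Suc m\<rfloor> div int N" by (rule floor_divide_real_eq_div) simp
    finally show ?thesis using that by (simp add: nat_div_distrib)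
  qed
  have "nat \<lfloor>t * real N ^ n\<rfloor> = nat \<lfloor>t' * real N ^ n\<rfloor>" using eq
  proof (induction n)
    case 0
    have "\<lfloor>t\<rfloor> = 0" "\<lfloor>t'\<rfloor> = 0" using t by (auto simp: floor_eq_iff)
    then show ?case by simp
  next
    case (Suc m)
    then have IH: "nat \<lfloor>t * real N ^ m\<rfloor> = nat \<lfloor>t' * real N ^ m\<rfloor>" by simp
    have "nat \<lfloor>t * real N ^ Suc m\<rfloor> mod N = nat \<lfloor>t' * real N ^ Suc m\<rfloor> mod N"
      using Suc.prems by (simp add: digit_def)
    then show ?case using IH div[of t m] div[of t' m] t
      by (metis atLeastLessThan_iff div_mult_mod_eq)
  qed
  moreover have "0 \<le> t * real N ^ n" "0 \<le> t' * real N ^ n" using t by auto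
  ultimately have "\<lfloor>t * real N ^ n\<rfloor> = \<lfloor>t' * real N ^ n\<rfloor>"
    by (metis nat_0_le zero_le_floor)
  then have "\<bar>t * real N ^ n - t' * real N ^ n\<bar> \<le> 1" by linarith
  then have "\<bar>t - t'\<bar> * real N ^ n \<le> 1" by (simp add: abs_mult flip: left_diff_distrib)
  then show ?thesis using N by (simp add: field_simps)
qed

text \<open>A mass distribution argument: the point \<open>x t\<close> determines \<open>t\<close>
  with Hoelder exponent \<open>s\<close>, so a cover of \<open>W\<close> with sum of
  \<open>diameter powr s\<close> below \<open>1 / (2 * N)\<close> would cover \<open>{0..<1}\<close>
  by intervals of total length below 1.\<close>

lemma winning_hausdorff_measure_pos:
  fixes W :: "real set"
  assumes \<alpha>: "0 < \<alpha>" "\<alpha> < 1" and win: "alpha_winning {0..1} \<alpha> W" and s: "0 < s" "s < 1"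
  shows "hausdorff_measure s W \<noteq> 0"
proof -
  \<comment> \<open>The condition on \<open>N\<close> is a rearrangement of
    \<open>1 / N \<le> (\<alpha> * \<beta>) powr s\<close> with
    \<open>\<beta> = 1 / (4 * N)\<close>; large \<open>N\<close> satisfy it because
    \<open>s < 1\<close>.\<close>
  have "filterlim (\<lambda>n::nat. real n powr (1 - s)) at_top sequentially"
    using s by (intro filterlim_compose[OF real_powr_at_top filterlim_real_sequentially]) auto
  then have "eventually (\<lambda>n::nat. (4 / \<alpha>) powr s \<le> real n powr (1 - s)) sequentially"
    by (simp add: filterlim_at_top)
  then have "eventually (\<lambda>n::nat. 0 < n \<and> (4 / \<alpha>) powr s \<le> real n powr (1 - s)) sequentially"
    using eventually_gt_at_top[of 0] by eventually_elim auto
  then obtain N :: nat where N: "0 < N" and Ns: "(4 / \<alpha>) powr s \<le> real N powr (1 - s)"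
    by (auto simp: eventually_sequentially)
  define \<beta> where "\<beta> = 1 / (4 * real N)"
  have \<beta>: "0 < \<beta>" "\<beta> < 1" using N by (auto simp: \<beta>_def field_simps)
  obtain f where f: "winning_strategy {0..1} \<alpha> \<beta> W f"
    using win \<beta> by (auto simp: alpha_winning_def alpha_beta_winning_def)
  obtain X where X: "\<And>d. \<forall>k. d k < N \<Longrightarrow> X d \<in> W"
    and sep: "\<And>d d' n. \<lbrakk>\<forall>k. d k < N; \<forall>k. d' k < N; \<forall>k<n. d k = d' k; d n \<noteq> d' n\<rbrakk> \<Longrightarrow>
        (\<alpha> * \<beta>) ^ Suc n \<le> \<bar>X d - X d'\<bar>"
    using winning_contains_cantor_set[OF f \<alpha> N \<beta>_def] by metis
  have dig: "\<forall>k. digit N t k < N" for t using N by (simp add: digit_def)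
  define x where "x = (\<lambda>t. X (digit N t))"
  have scale: "1 / real N \<le> (\<alpha> * \<beta>) powr s"
  proof -
    have "(\<alpha> * \<beta>) powr s = 1 / ((4 / \<alpha>) powr s * real N powr s)"
      using \<alpha> N by (simp add: \<beta>_def powr_divide powr_mult)
    moreover have "(4 / \<alpha>) powr s * real N powr s \<le> real N powr (1 - s) * real N powr s"
      using Ns by (intro mult_right_mono) auto
    moreover have "real N powr (1 - s) * real N powr s = real N" using N by (simp flip: powr_add)
    moreover have "0 < (4 / \<alpha>) powr s * real N powr s" using N \<alpha> by simp
    ultimately show ?thesis by (simp add: frac_le)
  qed
  have holder: "\<bar>t - t'\<bar> \<le> real N * \<bar>x t - x t'\<bar> powr s" if t: "t \<in> {0..<1}" "t' \<in> {0..<1}" for t t'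
  proof (cases "digit N t = digit N t'")
    case True
    have "\<bar>t - t'\<bar> \<le> 1 / real N ^ n" for n
      using digits_agree_imp_close[OF N t, of n] True by simp
    show ?thesis
    \<comment> \<open>For \<open>N = 1\<close> all digits agree, but the choice of \<open>N\<close>
      excludes this case, since \<open>4 / \<alpha>\<close> exceeds 1.\<close>
    proof (cases "N = 1")
      case False
      then have "(\<lambda>n. (1 / real N) ^ n) \<longlonglongrightarrow> 0" using N by (intro LIMSEQ_realpow_zero) auto
      then have "\<bar>t - t'\<bar> \<le> 0"
        using \<open>\<And>n. \<bar>t - t'\<bar> \<le> 1 / real N ^ n\<close>
        by (intro LIMSEQ_le_const) (auto simp: power_divide)
      then have "t = t'" by simp
      then show ?thesis by simp
    next
      case True
      have "1 < 4 / \<alpha>" using \<alpha> by simp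
      then have "1 < (4 / \<alpha>) powr s" using s by (simp add: gr_one_powr)
      then show ?thesis using Ns True by simp
    qed
  next
    case False
    then have "\<exists>n. digit N t n \<noteq> digit N t' n" by auto
    define n where "n = (LEAST n. digit N t n \<noteq> digit N t' n)"
    have n: "digit N t n \<noteq> digit N t' n"
      unfolding n_def by (rule LeastI_ex[OF \<open>\<exists>n. digit N t n \<noteq> digit N t' n\<close>])
    have lt: "\<forall>k<n. digit N t k = digit N t' k" unfolding n_def using not_less_Least by blast
    have "\<bar>t - t'\<bar> \<le> 1 / real N ^ n" by (rule digits_agree_imp_close[OF N t lt])
    also have "\<dots> = real N * (1 / real N) ^ Suc n" using N by (simp add: power_divide)
    also have "\<dots> \<le> real N * ((\<alpha> * \<beta>) powr s) ^ Suc n"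
      using scale N by (intro mult_left_mono power_mono) auto
    also have "((\<alpha> * \<beta>) powr s) ^ Suc n = ((\<alpha> * \<beta>) ^ Suc n) powr s"
      using \<alpha> \<beta> by (intro powr_power_commute) simp
    also have "real N * \<dots> \<le> real N * \<bar>x t - x t'\<bar> powr s"
      using sep[OF dig dig lt n] \<alpha> \<beta> s unfolding x_def
      by (intro mult_left_mono powr_mono2) auto
    finally show ?thesis .
  qed
  have premeasure: "ennreal (1 / (2 * real N)) \<le> hausdorff_premeasure s \<delta> W" for \<delta>
    unfolding hausdorff_premeasure_def
  proof (rule Inf_greatest, clarify)
    fix U :: "nat \<Rightarrow> real set"
    assume cover: "W \<subseteq> (\<Union>i. U i)" and U: "\<forall>i. bounded (U i) \<and> diameter (U i) \<le> \<delta>"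
    define T where "T = (\<lambda>i. {t \<in> {0..<1}. x t \<in> U i})"
    \<comment> \<open>Where \<open>T i\<close> is empty the centre is arbitrary, and the inclusion
      of \<open>T i\<close> into the interval is vacuous.\<close>
    define c where "c = (\<lambda>i. SOME t. t \<in> T i)"
    define D where "D = (\<lambda>i. real N * diameter (U i) powr s)"
    have D0: "0 \<le> D i" for i by (simp add: D_def)
    have TI: "T i \<subseteq> {c i - D i..c i + D i}" for i
    proof
      fix t assume t: "t \<in> T i"
      then have c: "c i \<in> T i" unfolding c_def by (rule someI)
      have "\<bar>t - c i\<bar> \<le> real N * \<bar>x t - x (c i)\<bar> powr s" using t c by (intro holder) (auto simp: T_def)
      also have "\<bar>x t - x (c i)\<bar> \<le> diameter (U i)"
        using diameter_bounded_bound[of "U i" "x t" "x (c i)"] U t c by (auto simp: T_def dist_real_def)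
      then have "real N * \<bar>x t - x (c i)\<bar> powr s \<le> D i"
        unfolding D_def using s by (intro mult_left_mono powr_mono2) auto
      finally show "t \<in> {c i - D i..c i + D i}" by auto
    qed
    have T_cover: "{0..<1} \<subseteq> (\<Union>i. T i)"
    proof
      fix t :: real assume "t \<in> {0..<1}"
      moreover have "x t \<in> W" unfolding x_def by (rule X[OF dig])
      ultimately show "t \<in> (\<Union>i. T i)" using cover by (auto simp: T_def)
    qed
    have sub: "{0..<1} \<subseteq> (\<Union>i. {c i - D i..c i + D i})"
      by (rule subset_trans[OF T_cover]) (intro UN_mono TI order_refl)
    have "ennreal 1 = emeasure lborel {0..<1::real}" by simp
    also have "\<dots> \<le> emeasure lborel (\<Union>i. {c i - D i..c i + D i})"
      using sub by (intro emeasure_mono) auto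
    also have "\<dots> \<le> (\<Sum>i. emeasure lborel {c i - D i..c i + D i})"
      by (intro emeasure_subadditive_countably) auto
    also have "\<dots> = (\<Sum>i. ennreal (2 * real N) * ennreal (diameter (U i) powr s))"
    proof (rule suminf_cong)
      fix i
      have "emeasure lborel {c i - D i..c i + D i} = ennreal (2 * D i)" using D0[of i] by simp
      also have "2 * D i = (2 * real N) * diameter (U i) powr s" by (simp add: D_def)
      also have "ennreal \<dots> = ennreal (2 * real N) * ennreal (diameter (U i) powr s)"
        by (rule ennreal_mult) auto
      finally show "emeasure lborel {c i - D i..c i + D i} = \<dots>" .
    qed
    also have "\<dots> = ennreal (2 * real N) * (\<Sum>i. ennreal (diameter (U i) powr s))" by simp
    finally have "ennreal 1 \<le> ennreal (2 * real N) * (\<Sum>i. ennreal (diameter (U i) powr s))" .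
    then have "ennreal (1 / (2 * real N)) * ennreal 1 \<le>
        ennreal (1 / (2 * real N)) * (ennreal (2 * real N) * (\<Sum>i. ennreal (diameter (U i) powr s)))"
      by (rule mult_left_mono) simp
    also have "\<dots> = (\<Sum>i. ennreal (diameter (U i) powr s))"
    proof -
      have "ennreal (1 / (2 * real N)) * ennreal (2 * real N) = ennreal (1 / (2 * real N) * (2 * real N))"
        by (rule ennreal_mult[symmetric]) auto
      also have "\<dots> = 1" using N by simp
      finally show ?thesis by (simp flip: mult.assoc)
    qed
    finally show "ennreal (1 / (2 * real N)) \<le> (\<Sum>i. ennreal (diameter (U i) powr s))" by simp
  qed
  have "hausdorff_premeasure s 1 W \<le> hausdorff_measure s W"
    unfolding hausdorff_measure_def by (rule SUP_upper) simp
  then have "ennreal (1 / (2 * real N)) \<le> hausdorff_measure s W" using premeasure order_trans by blast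
  moreover have "0 < ennreal (1 / (2 * real N))" using N by (subst ennreal_less_zero_iff) auto
  ultimately show ?thesis by auto
qed

section \<open>The upper bound and the value of the dimension\<close>

lemma hausdorff_measure_interval_zero:
  fixes W :: "real set"
  assumes W: "W \<subseteq> {0..1}" and s: "1 < s"
  shows "hausdorff_measure s W = 0"
proof -
  have "hausdorff_premeasure s \<delta> W \<le> 0" if \<delta>: "0 < \<delta>" for \<delta>
  proof (rule ennreal_le_epsilon)
    fix e :: real assume e: "0 < e"
    have "((\<lambda>x::real. x powr (1 - s)) \<longlongrightarrow> 0) at_top" using s by (intro tendsto_neg_powr filterlim_ident) auto
    then have "(\<lambda>n::nat. real n powr (1 - s)) \<longlonglongrightarrow> 0"
      using filterlim_compose filterlim_real_sequentially by blast
    then have "eventually (\<lambda>n::nat. real n powr (1 - s) < e) sequentially"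
      by (rule order_tendstoD) (rule e)
    moreover have "eventually (\<lambda>n::nat. 1 / real n < \<delta>) sequentially"
      by (rule order_tendstoD[OF lim_1_over_n]) (rule \<delta>)
    ultimately have "eventually (\<lambda>n::nat. real n powr (1 - s) < e \<and> 1 / real n < \<delta> \<and> 0 < n) sequentially"
      using eventually_gt_at_top[of 0] by eventually_elim auto
    then obtain n :: nat where n: "real n powr (1 - s) < e" "1 / real n < \<delta>" "0 < n"
      by (auto simp: eventually_sequentially)
    \<comment> \<open>The \<open>n\<close> intervals of length \<open>1 / n\<close> contribute
      \<open>n * (1 / n) powr s\<close>, which tends to 0 as \<open>s > 1\<close>. Empty sets fill
      up the sequence; their diameter 0 contributes \<open>0 powr s = 0\<close>.\<close>
    define U where "U = (\<lambda>i. if i < n then {real i / real n..(real i + 1) / real n} else {})"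
    have diam: "diameter (U i) = (if i < n then 1 / real n else 0)" for i
    proof -
      have "real i / real n \<le> (real i + 1) / real n" using n by (simp add: divide_right_mono)
      then show ?thesis using n by (auto simp: U_def diameter_closed_interval simp flip: diff_divide_distrib)
    qed
    have "W \<subseteq> (\<Union>i. U i)"
    proof
      fix w assume "w \<in> W"
      then have w: "0 \<le> w" "w \<le> 1" using W by auto
      show "w \<in> (\<Union>i. U i)"
      \<comment> \<open>The floor would give the right endpoint the index \<open>n\<close>, one
        beyond the last interval.\<close>
      proof (cases "w = 1")
        case True
        then have "w \<in> U (n - 1)" using n by (auto simp: U_def of_nat_diff)
        then show ?thesis by blast
      next
        case False
        define i where "i = nat \<lfloor>w * real n\<rfloor>"
        have i: "real i = real_of_int \<lfloor>w * real n\<rfloor>" using w by (simp add: i_def)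
        then have "real i \<le> w * real n" "w * real n < real i + 1" by linarith+
        moreover have "w * real n < 1 * real n" using w False n by (intro mult_strict_right_mono) auto
        ultimately have "real i < real n" by linarith
        then have "w \<in> U i" using \<open>real i \<le> w * real n\<close> \<open>w * real n < real i + 1\<close> n
          by (auto simp: U_def field_simps)
        then show ?thesis by blast
      qed
    qed
    moreover have "\<forall>i. bounded (U i) \<and> diameter (U i) \<le> \<delta>"
      unfolding diam using n \<delta> by (auto simp: U_def)
    ultimately have "hausdorff_premeasure s \<delta> W \<le> (\<Sum>i. ennreal (diameter (U i) powr s))"
      unfolding hausdorff_premeasure_def by (intro Inf_lower) blast
    also have "\<dots> = (\<Sum>i<n. ennreal (diameter (U i) powr s))"
      by (intro suminf_finite) (auto simp: diam)
    also have "\<dots> = ennreal (\<Sum>i<n. diameter (U i) powr s)" by simp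
    also have "(\<Sum>i<n. diameter (U i) powr s) = real n * (1 / real n) powr s" by (simp add: diam)
    also have "\<dots> = real n powr (1 - s)" using n by (simp add: powr_diff powr_divide)
    also have "ennreal \<dots> \<le> ennreal e" using n by (intro ennreal_leI) auto
    finally show "hausdorff_premeasure s \<delta> W \<le> 0 + ennreal e" by simp
  qed
  then have "hausdorff_measure s W \<le> 0" unfolding hausdorff_measure_def by (intro SUP_least) auto
  then show ?thesis by simp
qed

theorem winning_hausdorff_dim:
  fixes W :: "real set"
  assumes win: "schmidt_winning {0..1} W"
  shows "hausdorff_dim W = 1"
proof -
  obtain \<alpha> where \<alpha>: "0 < \<alpha>" "\<alpha> < 1" and w: "alpha_winning {0..1} \<alpha> W"
    using win by (auto simp: schmidt_winning_def)
  have W: "W \<subseteq> {0..1}"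
    using w[unfolded alpha_winning_def alpha_beta_winning_def, rule_format, of "1/2"] by simp
  show ?thesis unfolding hausdorff_dim_def
  proof (rule antisym)
    show "1 \<le> Inf {ennreal s |s. 0 < s \<and> hausdorff_measure s W = 0}"
    proof (rule Inf_greatest, clarify)
      fix s :: real assume "0 < s" "hausdorff_measure s W = 0"
      then have "1 \<le> s" using winning_hausdorff_measure_pos[OF \<alpha> w] not_le by blast
      then show "1 \<le> ennreal s" by simp
    qed
    show "Inf {ennreal s |s. 0 < s \<and> hausdorff_measure s W = 0} \<le> 1"
    \<comment> \<open>The measure for exponent 1 may be positive, so the value 1 is approached from
      above.\<close>
    proof (rule ennreal_le_epsilon)
      fix e :: real assume e: "0 < e"
      have "Inf {ennreal s |s. 0 < s \<and> hausdorff_measure s W = 0} \<le> ennreal (1 + e)"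
        using hausdorff_measure_interval_zero[OF W, of "1 + e"] e by (intro Inf_lower) fastforce
      then show "Inf {ennreal s |s. 0 < s \<and> hausdorff_measure s W = 0} \<le> 1 + ennreal e"
        using e by simp
    qed
  qed
qed

section \<open>The winning strategy\<close>

text \<open>Pigeonhole: among \<open>N + 1\<close> balls with centres
  \<open>4 * \<alpha> * r\<close> apart, a set \<open>D i\<close> meeting two of them would contain
  points at distance at least \<open>2 * \<alpha> * r\<close>, more than its diameter allows. So
  some ball misses every \<open>D i\<close>.\<close>

lemma free_subball:
  fixes x r \<alpha> :: real and N :: nat
  assumes x: "x \<in> {0..1}" and r: "0 < r" "r \<le> 1/2" and \<alpha>: "0 < \<alpha>" "4 * real (Suc N) * \<alpha> \<le> 1"
    and I: "finite I" "card I \<le> N" and cover: "E \<subseteq> (\<Union>i\<in>I. D i)"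
    and diam: "\<forall>i\<in>I. \<forall>s\<in>D i. \<forall>t\<in>D i. \<bar>s - t\<bar> \<le> \<alpha> * r"
  shows "\<exists>y\<in>{0..1}. ball_in {0..1} y (\<alpha> * r) \<subseteq> ball_in {0..1} x r \<and> ball_in {0..1} y (\<alpha> * r) \<inter> E = {}"
proof (rule ccontr)
  assume none: "\<not> ?thesis"
  obtain z where z: "\<And>j. j < Suc N \<Longrightarrow> z j \<in> {0..1} \<and> ball_in {0..1} (z j) (\<alpha> * r) \<subseteq> ball_in {0..1} x r"
    and sep: "\<And>i j. i < Suc N \<Longrightarrow> j < Suc N \<Longrightarrow> i \<noteq> j \<Longrightarrow> 4 * \<alpha> * r \<le> \<bar>z i - z j\<bar>"
    using separated_subballs[OF x r \<alpha>] by blast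
  have "\<exists>i\<in>I. ball_in {0..1} (z j) (\<alpha> * r) \<inter> D i \<noteq> {}" if "j \<in> {..<Suc N}" for j
  proof -
    have "ball_in {0..1} (z j) (\<alpha> * r) \<inter> E \<noteq> {}" using none z[of j] that by blast
    then show ?thesis using cover by blast
  qed
  then obtain i where i: "\<And>j. j \<in> {..<Suc N} \<Longrightarrow> i j \<in> I \<and> ball_in {0..1} (z j) (\<alpha> * r) \<inter> D (i j) \<noteq> {}"
    by metis
  have "card (i ` {..<Suc N}) \<le> card I" using i I(1) by (intro card_mono) auto
  then have "\<not> inj_on i {..<Suc N}" using I(2) card_image[of i "{..<Suc N}"] by auto
  then obtain j k where jk: "j < Suc N" "k < Suc N" "i j = i k" "j \<noteq> k" by (auto simp: inj_on_def)
  obtain s t where s: "s \<in> ball_in {0..1} (z j) (\<alpha> * r)" "s \<in> D (i j)"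
    and t: "t \<in> ball_in {0..1} (z k) (\<alpha> * r)" "t \<in> D (i j)"
    using i[of j] i[of k] jk by auto
  have "\<bar>z j - s\<bar> \<le> \<alpha> * r" "\<bar>z k - t\<bar> \<le> \<alpha> * r" using s(1) t(1) by (auto simp: ball_in_def dist_real_def)
  moreover have "\<bar>s - t\<bar> \<le> \<alpha> * r" using diam i[of j] jk s(2) t(2) by auto
  moreover have "0 < \<alpha> * r" using \<alpha> r by simp
  ultimately show False using sep[OF jk(1,2,4)] by linarith
qed

text \<open>The strategy moves to a ball missing the current danger set whenever there is one. The
  outcome lies in all of Player B's balls, hence outside the danger set of every stage with radius
  at most 1/2, where such balls exist. The danger may depend on the whole play so far, which lets
  the strategy change its aim.\<close>

lemma avoidance_winning:
  fixes W :: "real set" and Danger :: "real \<Rightarrow> real list \<Rightarrow> real set" and N :: nat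
  assumes \<alpha>: "0 < \<alpha>" "4 * real (Suc N) * \<alpha> \<le> 1" and \<beta>: "0 < \<beta>" "\<beta> < 1" and W: "W \<subseteq> {0..1}"
    and cover: "\<And>\<rho> xs r. \<lbrakk>0 < \<rho>; xs \<noteq> []; r = (\<alpha> * \<beta>) ^ (length xs - 1) * \<rho>; last xs \<in> {0..1}; r \<le> 1/2\<rbrakk> \<Longrightarrow>
       \<exists>(I :: 'i set) D. finite I \<and> card I \<le> N \<and> Danger \<rho> xs \<subseteq> (\<Union>i\<in>I. D i) \<and>
         (\<forall>i\<in>I. \<forall>s\<in>D i. \<forall>t\<in>D i. \<bar>s - t\<bar> \<le> \<alpha> * r)"
    and win: "\<And>\<rho> x w. \<lbrakk>0 < \<rho>; \<And>n. w \<in> ball_in {0..1} (x n) ((\<alpha> * \<beta>) ^ n * \<rho>);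
         \<And>n. (\<alpha> * \<beta>) ^ n * \<rho> \<le> 1/2 \<Longrightarrow> w \<notin> Danger \<rho> (map x [0..<Suc n])\<rbrakk> \<Longrightarrow> w \<in> W"
  shows "alpha_beta_winning {0..1} \<alpha> \<beta> W"
proof -
  have "4 * \<alpha> \<le> 4 * real (Suc N) * \<alpha>" using \<alpha>(1) by simp
  then have \<alpha>1: "\<alpha> < 1" using \<alpha> by linarith
  have T: "0 < \<alpha> * \<beta>" "\<alpha> * \<beta> < 1"
    using \<alpha>(1) \<alpha>1 \<beta> mult_strict_mono[of \<alpha> 1 \<beta> 1] by auto
  define ok where "ok = (\<lambda>\<rho> xs y. y \<in> {0..1} \<and>
     ball_in {0..1} y (\<alpha> * ((\<alpha> * \<beta>) ^ (length xs - 1) * \<rho>)) \<subseteq> ball_in {0..1} (last xs) ((\<alpha> * \<beta>) ^ (length xs - 1) * \<rho>) \<and>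
     ball_in {0..1} y (\<alpha> * ((\<alpha> * \<beta>) ^ (length xs - 1) * \<rho>)) \<inter> Danger \<rho> xs = {})"
  \<comment> \<open>Keeping the centre is the fallback; it is a legal move because
    \<open>\<alpha> < 1\<close>.\<close>
  define f where "f = (\<lambda>\<rho> xs. if \<exists>y. ok \<rho> xs y then SOME y. ok \<rho> xs y else last xs)"
  have ok_f: "ok \<rho> xs (f \<rho> xs)" if "\<exists>y. ok \<rho> xs y" for \<rho> xs
    using that by (simp add: f_def someI_ex)
  have "winning_strategy {0..1} \<alpha> \<beta> W f"
    unfolding winning_strategy_def
  proof (intro allI impI conjI)
    fix \<rho> :: real and x y :: "nat \<Rightarrow> real"
    assume \<rho>: "0 < \<rho>" and y: "\<forall>n. y n = f \<rho> (map x [0..<Suc n])"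
    define r where "r = (\<lambda>n. (\<alpha> * \<beta>) ^ n * \<rho>)"
    have r: "0 < r n" for n using T \<rho> by (simp add: r_def)
    have last: "last (map x [0..<Suc n]) = x n" for n by simp
    have len: "length (map x [0..<Suc n]) - 1 = n" for n by simp
    have okn: "ok \<rho> (map x [0..<Suc n]) v \<longleftrightarrow> v \<in> {0..1} \<and>
        ball_in {0..1} v (\<alpha> * r n) \<subseteq> ball_in {0..1} (x n) (r n) \<and>
        ball_in {0..1} v (\<alpha> * r n) \<inter> Danger \<rho> (map x [0..<Suc n]) = {}" for n v
      unfolding ok_def last len r_def ..
    have A: "A_ball {0..1} \<alpha> \<beta> \<rho> x n = ball_in {0..1} (x n) (r n)" for n by (simp add: A_ball_def r_def)
    have B: "B_ball {0..1} \<alpha> \<beta> \<rho> y n = ball_in {0..1} (y n) (\<alpha> * r n)" for n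
      by (simp add: B_ball_def r_def mult.assoc)
    have legal: "legal_B {0..1} \<alpha> \<beta> \<rho> x y n" if x: "x n \<in> {0..1}" for n
    proof (cases "\<exists>v. ok \<rho> (map x [0..<Suc n]) v")
      case True
      then show ?thesis using ok_f[OF True] y unfolding legal_B_def A B okn by auto
    next
      case False
      have "y n = f \<rho> (map x [0..<Suc n])" using y by blast
      also have "\<dots> = x n" unfolding f_def using False last[of n] by (simp only: if_False)
      finally have "y n = x n" .
      moreover have "\<alpha> * r n \<le> r n" using \<alpha>1 r[of n] by simp
      ultimately show ?thesis using x unfolding legal_B_def A B by (auto simp: ball_in_def)
    qed
    show "legal_B {0..1} \<alpha> \<beta> \<rho> x y n" if "\<forall>k\<le>n. legal_A {0..1} \<alpha> \<beta> \<rho> x y k" for n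
      using that by (intro legal) (auto simp: legal_A_def)
    assume "\<forall>n. legal_A {0..1} \<alpha> \<beta> \<rho> x y n"
    then have x: "x n \<in> {0..1}" and AB: "ball_in {0..1} (x (Suc n)) (r (Suc n)) \<subseteq> ball_in {0..1} (y n) (\<alpha> * r n)" for n
      unfolding legal_A_def A B by auto
    have BA: "ball_in {0..1} (y n) (\<alpha> * r n) \<subseteq> ball_in {0..1} (x n) (r n)" for n
      using legal[OF x] unfolding legal_B_def A B by auto
    have r_lim: "r \<longlonglongrightarrow> 0" unfolding r_def
      using T by (intro tendsto_mult_left_zero LIMSEQ_realpow_zero) auto
    have "\<exists>w. (\<Inter>n. ball_in {0..1} (x n) (r n)) = {w}"
    proof (rule decreasing_closed_nest_sing)
      show "closed (ball_in {0..1} (x n) (r n))" for n by (auto simp: ball_in_def intro!: closed_Int)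
      show "ball_in {0..1} (x n) (r n) \<noteq> {}" for n
        using x[of n] r[of n] by (force simp: ball_in_def)
      show "ball_in {0..1} (x n) (r n) \<subseteq> ball_in {0..1} (x m) (r m)" if "m \<le> n" for m n
        using AB BA by (intro lift_Suc_antimono_le[OF _ that]) blast
      show "\<exists>n. \<forall>u\<in>ball_in {0..1} (x n) (r n). \<forall>v\<in>ball_in {0..1} (x n) (r n). dist u v < e" if e: "0 < e" for e
      proof -
        have "eventually (\<lambda>n. r n < e / 2) sequentially" using e by (intro order_tendstoD(2)[OF r_lim]) simp
        then obtain n where n: "r n < e / 2" by (auto simp: eventually_sequentially)
        show ?thesis by (intro exI[of _ n] ballI) (use n in \<open>auto simp: ball_in_def dist_real_def\<close>)
      qed
    qed
    then obtain w where w: "(\<Inter>n. ball_in {0..1} (x n) (r n)) = {w}" by blast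
    then have w_in: "w \<in> ball_in {0..1} (x n) (r n)" for n by blast
    have "w \<in> W"
    proof (rule win[OF \<rho>])
      show "w \<in> ball_in {0..1} (x n) ((\<alpha> * \<beta>) ^ n * \<rho>)" for n using w_in[of n] by (simp add: r_def)
      fix n assume small: "(\<alpha> * \<beta>) ^ n * \<rho> \<le> 1/2"
      have rn: "r n \<le> 1/2" using small by (simp add: r_def)
      have "\<exists>(I :: 'i set) D. finite I \<and> card I \<le> N \<and> Danger \<rho> (map x [0..<Suc n]) \<subseteq> (\<Union>i\<in>I. D i) \<and>
         (\<forall>i\<in>I. \<forall>s\<in>D i. \<forall>t\<in>D i. \<bar>s - t\<bar> \<le> \<alpha> * r n)"
        by (rule cover[OF \<rho>]) (use x[of n] rn in \<open>auto simp: r_def\<close>)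
      then obtain I :: "'i set" and D where "finite I" "card I \<le> N" "Danger \<rho> (map x [0..<Suc n]) \<subseteq> (\<Union>i\<in>I. D i)"
        "\<forall>i\<in>I. \<forall>s\<in>D i. \<forall>t\<in>D i. \<bar>s - t\<bar> \<le> \<alpha> * r n" by blast
      from free_subball[OF x r rn \<alpha> this] have "\<exists>v. ok \<rho> (map x [0..<Suc n]) v" unfolding okn by blast
      from ok_f[OF this] have "ok \<rho> (map x [0..<Suc n]) (y n)" by (simp only: y[rule_format])
      then have "ball_in {0..1} (y n) (\<alpha> * r n) \<inter> Danger \<rho> (map x [0..<Suc n]) = {}"
        unfolding okn by blast
      moreover have "w \<in> ball_in {0..1} (y n) (\<alpha> * r n)" using w_in[of "Suc n"] AB by blast
      ultimately show "w \<notin> Danger \<rho> (map x [0..<Suc n])" by blast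
    qed
    then show "\<exists>w\<in>W. (\<Inter>n. A_ball {0..1} \<alpha> \<beta> \<rho> x n) = {w}" unfolding A using w by blast
  qed
  then show ?thesis using W by (auto simp: alpha_beta_winning_def)
qed

section \<open>Lipschitz and expansion estimates for the curve\<close>

lemma vector_derivative_lipschitz:
  fixes f f' :: "real \<Rightarrow> complex"
  assumes U: "convex U" and d: "\<And>x. x \<in> U \<Longrightarrow> (f has_vector_derivative f' x) (at x within U)"
    and b: "\<And>x. x \<in> U \<Longrightarrow> cmod (f' x) \<le> L" and st: "s \<in> U" "t \<in> U"
  shows "cmod (f s - f t) \<le> L * \<bar>s - t\<bar>"
proof -
  have "onorm (\<lambda>h. h *\<^sub>R f' x) \<le> L" if "x \<in> U" for x
    using b[OF that] by (simp add: onorm_scaleR_left onorm_id)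
  then have "norm (f s - f t) \<le> L * norm (s - t)"
    using d by (intro differentiable_bound[OF U _ _ st]) (auto simp: has_vector_derivative_def)
  then show ?thesis by simp
qed

lemma curve_lipschitz:
  fixes f f' :: "'b \<Rightarrow> real \<Rightarrow> complex"
  assumes "finite S" and d: "\<And>\<sigma> x. \<sigma> \<in> S \<Longrightarrow> x \<in> {0..1} \<Longrightarrow> (f \<sigma> has_vector_derivative f' \<sigma> x) (at x within {0..1})"
    and c: "\<And>\<sigma>. \<sigma> \<in> S \<Longrightarrow> continuous_on {0..1} (f' \<sigma>)"
  shows "\<exists>L\<ge>0. \<forall>\<sigma>\<in>S. \<forall>s\<in>{0..1}. \<forall>t\<in>{0..1}. cmod (f \<sigma> s - f \<sigma> t) \<le> L * \<bar>s - t\<bar>"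
proof -
  have "bounded (f' \<sigma> ` {0..1})" if "\<sigma> \<in> S" for \<sigma>
    using c[OF that] by (intro compact_imp_bounded compact_continuous_image) auto
  then have "bounded (\<Union>\<sigma>\<in>S. f' \<sigma> ` {0..1})" using \<open>finite S\<close> by (intro bounded_UN) auto
  then obtain L where L: "\<And>\<sigma> x. \<sigma> \<in> S \<Longrightarrow> x \<in> {0..1} \<Longrightarrow> cmod (f' \<sigma> x) \<le> L"
    unfolding bounded_iff by blast
  have "cmod (f \<sigma> s - f \<sigma> t) \<le> max L 0 * \<bar>s - t\<bar>" if "\<sigma> \<in> S" "s \<in> {0..1}" "t \<in> {0..1}" for \<sigma> s t
    using d[OF that(1)] L[OF that(1)] that
    by (intro vector_derivative_lipschitz[where U = "{0..1}" and f' = "f' \<sigma>"]) (auto simp: le_max_iff_disj)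
  then show ?thesis by (intro exI[of _ "max L 0"]) auto
qed

text \<open>Subtracting the linear map with slope \<open>f' w\<close> leaves a function with small
  derivative near \<open>w\<close>, hence with Lipschitz constant \<open>cmod (f' w) / 2\<close>.
  The linear part stretches by \<open>cmod (f' w)\<close>, and the triangle inequality leaves half
  of that.\<close>

lemma locally_expanding:
  fixes f f' :: "real \<Rightarrow> complex"
  assumes d: "\<And>x. x \<in> {0..1} \<Longrightarrow> (f has_vector_derivative f' x) (at x within {0..1})"
    and c: "continuous_on {0..1} f'" and w: "w \<in> {0..1}" "f' w \<noteq> 0"
  shows "\<exists>\<delta>>0. \<forall>s\<in>ball w \<delta> \<inter> {0..1}. \<forall>t\<in>ball w \<delta> \<inter> {0..1}. cmod (f' w) / 2 * \<bar>s - t\<bar> \<le> cmod (f s - f t)"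
proof -
  obtain \<delta> where \<delta>: "0 < \<delta>" "\<And>x. x \<in> {0..1} \<Longrightarrow> dist x w < \<delta> \<Longrightarrow> dist (f' x) (f' w) < cmod (f' w) / 2"
    using c w unfolding continuous_on_iff by (meson half_gt_zero zero_less_norm_iff)
  define U where "U = ball w \<delta> \<inter> {0..1}"
  define g where "g = (\<lambda>x. f x - x *\<^sub>R f' w)"
  have "cmod (f' w) / 2 * \<bar>s - t\<bar> \<le> cmod (f s - f t)" if st: "s \<in> U" "t \<in> U" for s t
  proof -
    have "cmod (g s - g t) \<le> cmod (f' w) / 2 * \<bar>s - t\<bar>"
    proof (rule vector_derivative_lipschitz[OF _ _ _ st])
      show "convex U" unfolding U_def by (intro convex_Int) auto
      show "(g has_vector_derivative f' x - f' w) (at x within U)" if "x \<in> U" for x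
      proof -
        have "(f has_vector_derivative f' x) (at x within U)"
          by (rule has_vector_derivative_within_subset[OF d]) (use that in \<open>auto simp: U_def\<close>)
        then show ?thesis unfolding g_def by (auto intro!: derivative_eq_intros)
      qed
      show "cmod (f' x - f' w) \<le> cmod (f' w) / 2" if "x \<in> U" for x
      proof -
        have "x \<in> {0..1}" "dist x w < \<delta>" using that by (simp_all add: U_def dist_commute)
        from \<delta>(2)[OF this] show ?thesis by (simp add: dist_norm)
      qed
    qed
    moreover have "cmod ((s - t) *\<^sub>R f' w) = \<bar>s - t\<bar> * cmod (f' w)" by simp
    moreover have "(s - t) *\<^sub>R f' w = (f s - f t) - (g s - g t)" by (simp add: g_def algebra_simps)
    then have "cmod ((s - t) *\<^sub>R f' w) \<le> cmod (f s - f t) + cmod (g s - g t)"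
      by (metis norm_triangle_ineq4)
    ultimately show ?thesis by (simp add: mult.commute)
  qed
  then show ?thesis using \<delta>(1) unfolding U_def by blast
qed

lemma locally_expanding_finite:
  fixes f f' :: "'b \<Rightarrow> real \<Rightarrow> complex"
  assumes "finite A" and d: "\<And>\<sigma> x. \<sigma> \<in> A \<Longrightarrow> x \<in> {0..1} \<Longrightarrow> (f \<sigma> has_vector_derivative f' \<sigma> x) (at x within {0..1})"
    and c: "\<And>\<sigma>. \<sigma> \<in> A \<Longrightarrow> continuous_on {0..1} (f' \<sigma>)"
    and w: "w \<in> {0..1}" "\<And>\<sigma>. \<sigma> \<in> A \<Longrightarrow> f' \<sigma> w \<noteq> 0"
  shows "\<exists>\<delta>>0. \<exists>\<mu>>0. \<forall>\<sigma>\<in>A. \<forall>s\<in>ball w \<delta> \<inter> {0..1}. \<forall>t\<in>ball w \<delta> \<inter> {0..1}. \<mu> * \<bar>s - t\<bar> \<le> cmod (f \<sigma> s - f \<sigma> t)"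
  using assms
proof (induction A rule: finite_induct)
  case empty
  show ?case by (intro exI[of _ 1] conjI) auto
next
  case (insert \<tau> A)
  then obtain \<delta> \<mu> where \<delta>: "0 < \<delta>" "0 < \<mu>" "\<And>\<sigma> s t. \<sigma> \<in> A \<Longrightarrow> s \<in> ball w \<delta> \<inter> {0..1} \<Longrightarrow> t \<in> ball w \<delta> \<inter> {0..1} \<Longrightarrow>
      \<mu> * \<bar>s - t\<bar> \<le> cmod (f \<sigma> s - f \<sigma> t)" by auto
  obtain \<delta>' where \<delta>': "0 < \<delta>'" "\<And>s t. s \<in> ball w \<delta>' \<inter> {0..1} \<Longrightarrow> t \<in> ball w \<delta>' \<inter> {0..1} \<Longrightarrow>
      cmod (f' \<tau> w) / 2 * \<bar>s - t\<bar> \<le> cmod (f \<tau> s - f \<tau> t)"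
    using locally_expanding[of "f \<tau>" "f' \<tau>" w] insert.prems by auto
  define \<nu> where "\<nu> = min \<mu> (cmod (f' \<tau> w) / 2)"
  have "\<nu> * \<bar>s - t\<bar> \<le> cmod (f \<sigma> s - f \<sigma> t)"
    if "\<sigma> \<in> insert \<tau> A" "s \<in> ball w (min \<delta> \<delta>') \<inter> {0..1}" "t \<in> ball w (min \<delta> \<delta>') \<inter> {0..1}" for \<sigma> s t
  proof (cases "\<sigma> = \<tau>")
    case True
    have "\<nu> * \<bar>s - t\<bar> \<le> cmod (f' \<tau> w) / 2 * \<bar>s - t\<bar>" by (intro mult_right_mono) (auto simp: \<nu>_def)
    also have "\<dots> \<le> cmod (f \<tau> s - f \<tau> t)" using that by (intro \<delta>') auto
    finally show ?thesis using True by simp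
  next
    case False
    have "\<nu> * \<bar>s - t\<bar> \<le> \<mu> * \<bar>s - t\<bar>" by (intro mult_right_mono) (auto simp: \<nu>_def)
    also have "\<dots> \<le> cmod (f \<sigma> s - f \<sigma> t)" using that False by (intro \<delta>) auto
    finally show ?thesis .
  qed
  moreover have "0 < \<nu>" using \<delta>(2) insert.prems(4)[of \<tau>] by (simp add: \<nu>_def)
  ultimately show ?case using \<delta>(1) \<delta>'(1) by (intro exI[of _ "min \<delta> \<delta>'"] conjI exI[of _ \<nu>]) auto
qed


section \<open>Constants and assembly of the strategy\<close>

context represented_numfield
begin

text \<open>On such a ball the strategy can leave the exceptional points behind: one set
  \<open>A\<close> and one rate \<mu> serve at all its points. The bound 1/2 on the radius is the
  one under which free balls are available.\<close>

definition good_ball :: "(real \<Rightarrow> ('k \<Rightarrow> complex) \<Rightarrow> complex) \<Rightarrow> real \<Rightarrow> real \<Rightarrow> ('k \<Rightarrow> complex) set \<Rightarrow> real \<Rightarrow> bool" where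
  "good_ball \<phi> x r A \<mu> \<longleftrightarrow> r \<le> 1/2 \<and> active_places S A \<and> 0 < \<mu> \<and>
     (\<forall>\<sigma>\<in>A. \<forall>s\<in>ball_in {0..1} x r. \<forall>t\<in>ball_in {0..1} x r. \<mu> * \<bar>s - t\<bar> \<le> cmod (\<phi> s \<sigma> - \<phi> t \<sigma>))"

lemma nearby_good_ball:
  assumes d: "\<And>\<sigma> x. \<sigma> \<in> S \<Longrightarrow> x \<in> {0..1} \<Longrightarrow> ((\<lambda>t. \<phi> t \<sigma>) has_vector_derivative \<phi>' x \<sigma>) (at x within {0..1})"
    and c: "\<And>\<sigma>. \<sigma> \<in> S \<Longrightarrow> continuous_on {0..1} (\<lambda>t. \<phi>' t \<sigma>)"
    and w: "w \<in> {0..1}" and A: "A \<subseteq> S" "\<And>\<sigma>. \<sigma> \<in> A \<Longrightarrow> \<phi>' w \<sigma> \<noteq> 0"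
      "field_degree TYPE('k) div 2 < card {\<sigma> \<in> A. real_embedding \<sigma>} + 2 * card {\<sigma> \<in> A. complex_embedding \<sigma>}"
  shows "\<exists>\<delta>>0. \<exists>\<mu>. \<forall>x r. w \<in> ball_in {0..1} x r \<longrightarrow> r < \<delta> \<longrightarrow> good_ball \<phi> x r A \<mu>"
proof -
  have act: "active_places S A"
    using A(1,3) unfolding weighted_card_eq_sum[OF A(1)] by unfold_locales
  have "finite A" using A(1) finite_S finite_subset by blast
  then have "\<exists>\<delta>>0. \<exists>\<mu>>0. \<forall>\<sigma>\<in>A. \<forall>s\<in>ball w \<delta> \<inter> {0..1}. \<forall>t\<in>ball w \<delta> \<inter> {0..1}.
      \<mu> * \<bar>s - t\<bar> \<le> cmod (\<phi> s \<sigma> - \<phi> t \<sigma>)"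
    using d c w A(1,2) by (intro locally_expanding_finite[where f' = "\<lambda>\<sigma> t. \<phi>' t \<sigma>"]) auto
  then obtain \<delta> \<mu> where \<delta>: "0 < \<delta>" "0 < \<mu>" "\<forall>\<sigma>\<in>A. \<forall>s\<in>ball w \<delta> \<inter> {0..1}. \<forall>t\<in>ball w \<delta> \<inter> {0..1}.
      \<mu> * \<bar>s - t\<bar> \<le> cmod (\<phi> s \<sigma> - \<phi> t \<sigma>)"
    by blast
  \<comment> \<open>A ball of radius \<open>r\<close> containing \<open>w\<close> lies within
    distance \<open>2 * r\<close> of \<open>w\<close>, whence the bound
    \<open>\<delta> / 2\<close>.\<close>
  have "good_ball \<phi> x r A \<mu>" if "w \<in> ball_in {0..1} x r" "r < min (1/2) (\<delta> / 2)" for x r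
  proof -
    have sub: "ball_in {0..1} x r \<subseteq> ball w \<delta> \<inter> {0..1}"
      using that by (auto simp: ball_in_def dist_real_def)
    have "r \<le> 1/2" using that by simp
    then show ?thesis unfolding good_ball_def using act \<delta>(2,3) subsetD[OF sub] by (intro conjI ballI) simp_all
  qed
  then show ?thesis using \<delta>(1) by (intro exI[of _ "min (1/2) (\<delta> / 2)"] conjI exI[of _ \<mu>]) auto
qed

text \<open>From stage \<open>k\<close> on the windows abut, and
  \<open>\<kappa> \<le> T ^ k * \<rho>\<close> makes the first one begin at or below 1. As
  \<open>max_abs S q * max_abs A q\<close> is at least 1, every denominator falls into some window,
  and escaping it means that some place has an error above \<open>c / max_abs S q\<close>.\<close>

lemma escape_imp_Bad:
  assumes act: "active_places S A" and \<phi>: "\<phi> w \<in> K_space S"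
    and T: "0 < T" "T < 1" and \<rho>: "0 < \<rho>" and c: "0 < c" and \<kappa>: "0 < \<kappa>" "\<kappa> \<le> T ^ k * \<rho>"
    and J: "\<And>n. k \<le> n \<Longrightarrow> w \<in> J n"
    and esc: "\<And>n. k \<le> n \<Longrightarrow> w \<notin> active_places.dangerous S A (J n) \<phi> c (\<kappa> / (T ^ n * \<rho>)) (\<kappa> / (T * (T ^ n * \<rho>)))"
  shows "\<phi> w \<in> Bad S"
proof -
  interpret active_places S A by (rule act)
  have "c < Max ((\<lambda>\<sigma>. cmod (\<sigma> p + \<phi> w \<sigma> * \<sigma> q)) ` S) * Max ((\<lambda>\<sigma>. cmod (\<sigma> q)) ` S)"
    if p: "algebraic_int p" and q: "algebraic_int q" "q \<noteq> 0" for p q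
  proof -
    define h where "h = max_abs S q * max_abs A q"
    have h1: "1 \<le> h" unfolding h_def by (rule max_abs_product_ge_1[OF q])
    let ?P = "\<lambda>n. k \<le> n \<and> h < \<kappa> / (T * (T ^ n * \<rho>))"
    have "0 < \<kappa> / (h * \<rho>)" using \<kappa> h1 \<rho> by simp
    then obtain m where m: "T ^ m < \<kappa> / (h * \<rho>)" using real_arch_pow_inv T by blast
    have "T ^ Suc (max m k) \<le> T ^ m" using T by (intro power_decreasing) auto
    then have "T ^ Suc (max m k) < \<kappa> / (h * \<rho>)" using m by linarith
    then have "?P (max m k)" using T \<rho> h1 by (simp add: field_simps)
    then have ex: "\<exists>n. ?P n" by blast
    \<comment> \<open>At the least stage whose window ends above \<open>h\<close>, minimality yields
      the lower end of the window.\<close>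
    define n where "n = (LEAST n. ?P n)"
    have n: "k \<le> n" "h < \<kappa> / (T * (T ^ n * \<rho>))" using LeastI_ex[OF ex] unfolding n_def by auto
    have lower: "\<kappa> / (T ^ n * \<rho>) \<le> h"
    proof (cases "n = k")
      case True
      then have "\<kappa> / (T ^ n * \<rho>) \<le> 1" using \<kappa> T \<rho> by simp
      then show ?thesis using h1 by linarith
    next
      case False
      then obtain j where j: "n = Suc j" "k \<le> j" using n(1) by (cases n) auto
      then have "\<not> ?P j" using not_less_Least[of j ?P] unfolding n_def[symmetric] by simp
      then show ?thesis using j by (simp add: mult.assoc)
    qed
    have "\<not> (\<forall>\<sigma>\<in>S. cmod (\<sigma> p + \<phi> w \<sigma> * \<sigma> q) \<le> c / max_abs S q)"
      using esc[OF n(1)] J[OF n(1)] p q lower n(2) unfolding dangerous_def h_def by blast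
    then obtain \<sigma> where \<sigma>: "\<sigma> \<in> S" "c / max_abs S q < cmod (\<sigma> p + \<phi> w \<sigma> * \<sigma> q)" by force
    have "cmod (\<sigma> p + \<phi> w \<sigma> * \<sigma> q) \<le> Max ((\<lambda>\<sigma>. cmod (\<sigma> p + \<phi> w \<sigma> * \<sigma> q)) ` S)"
      using \<sigma>(1) finite_S by (intro Max_ge) auto
    then have "c / max_abs S q < Max ((\<lambda>\<sigma>. cmod (\<sigma> p + \<phi> w \<sigma> * \<sigma> q)) ` S)" using \<sigma>(2) by linarith
    then show ?thesis using max_abs_S_ge_1[OF q] by (simp add: pos_divide_less_eq flip: max_abs_def)
  qed
  then show ?thesis using \<phi> c by (auto simp: Bad_def ring_of_integers_def)
qed

lemma badly_approximable_winning:
  assumes \<phi>: "\<phi> \<in> {0..1} \<rightarrow> K_space S"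
    and d: "\<And>\<sigma> x. \<sigma> \<in> S \<Longrightarrow> x \<in> {0..1} \<Longrightarrow> ((\<lambda>t. \<phi> t \<sigma>) has_vector_derivative \<phi>' x \<sigma>) (at x within {0..1})"
    and cont: "\<And>\<sigma>. \<sigma> \<in> S \<Longrightarrow> continuous_on {0..1} (\<lambda>t. \<phi>' t \<sigma>)"
    and E: "finite E"
    and nondeg: "\<And>x. x \<in> {0..1} - E \<Longrightarrow> \<exists>A\<subseteq>S. (\<forall>\<sigma>\<in>A. \<phi>' x \<sigma> \<noteq> 0) \<and>
           field_degree TYPE('k) div 2 < card {\<sigma> \<in> A. real_embedding \<sigma>} + 2 * card {\<sigma> \<in> A. complex_embedding \<sigma>}"
  shows "schmidt_winning {0..1} {x \<in> {0..1}. \<phi> x \<in> Bad S}"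
proof -
  \<comment> \<open>Room for either kind of danger: at most one short set per place, or one per
    exceptional point. The resulting \<alpha> is the same for every \<beta>.\<close>
  define N where "N = card S + card E"
  define \<alpha> where "\<alpha> = 1 / (4 * real (Suc N))"
  have \<alpha>: "0 < \<alpha>" "4 * real (Suc N) * \<alpha> \<le> 1" "\<alpha> < 1" by (auto simp: \<alpha>_def field_simps)
  obtain L where L: "0 \<le> L" "\<And>\<sigma> s t. \<sigma> \<in> S \<Longrightarrow> s \<in> {0..1} \<Longrightarrow> t \<in> {0..1} \<Longrightarrow> cmod (\<phi> s \<sigma> - \<phi> t \<sigma>) \<le> L * \<bar>s - t\<bar>"
    using curve_lipschitz[of S "\<lambda>\<sigma> t. \<phi> t \<sigma>" "\<lambda>\<sigma> t. \<phi>' t \<sigma>"] finite_S d cont by blast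
  \<comment> \<open>The choice of \<open>A\<close> and \<mu> depends on the ball alone, so it can be
    repeated identically at all later stages.\<close>
  have "\<exists>Am. (\<exists>A \<mu>. good_ball \<phi> x r A \<mu>) \<longrightarrow> good_ball \<phi> x r (fst Am) (snd Am)" for x r by auto
  then obtain Am where Am: "\<And>x r. \<exists>A \<mu>. good_ball \<phi> x r A \<mu> \<Longrightarrow> good_ball \<phi> x r (fst (Am x r)) (snd (Am x r))"
    by metis
  have "alpha_beta_winning {0..1} \<alpha> \<beta> {x \<in> {0..1}. \<phi> x \<in> Bad S}" if \<beta>: "0 < \<beta>" "\<beta> < 1" for \<beta>
  proof -
    define T where "T = \<alpha> * \<beta>"
    have T: "0 < T" "T < 1" using \<alpha>(1,3) \<beta> mult_strict_mono[of \<alpha> 1 \<beta> 1] by (auto simp: T_def)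
    \<comment> \<open>The bound \<open>r\<close> lets the first window begin at or below 1; the
      other bound keeps \<open>2 * L * \<kappa> r / T\<^sup>2\<close> under 1/2, with
      \<open>L + 1\<close> guarding against \<open>L = 0\<close>.\<close>
    define \<kappa> where "\<kappa> = (\<lambda>r. min r (T\<^sup>2 / (4 * (L + 1))))"
    \<comment> \<open>The bound \<open>T / 4\<close> accounts for the other 1/2 in the norm
      estimate, the second bound for the length \<open>\<alpha> * r\<close> of the dangerous
      sets.\<close>
    define c where "c = (\<lambda>x r. min (T / 4) (\<alpha> * \<kappa> r * snd (Am x r) / 2))"
    have \<kappa>: "0 < \<kappa> r" "\<kappa> r \<le> r" "2 * L * \<kappa> r / T\<^sup>2 < 1 / 2" if "0 < r" for r
    proof -
      show "0 < \<kappa> r" "\<kappa> r \<le> r" using that T L by (auto simp: \<kappa>_def)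
      have "2 * L * \<kappa> r / T\<^sup>2 \<le> 2 * L * (T\<^sup>2 / (4 * (L + 1))) / T\<^sup>2"
        using L T by (intro divide_right_mono mult_left_mono) (auto simp: \<kappa>_def)
      also have "\<dots> = 2 * L / (4 * (L + 1))" using T by simp
      also have "\<dots> < 1 / 2" using L(1) by (subst pos_divide_less_eq) auto
      finally show "2 * L * \<kappa> r / T\<^sup>2 < 1 / 2" .
    qed
    have c: "0 < c x r" "2 * c x r / T + 2 * L * \<kappa> r / T\<^sup>2 < 1" "2 * c x r \<le> \<alpha> * \<kappa> r * snd (Am x r)"
      if "good_ball \<phi> x r (fst (Am x r)) (snd (Am x r))" "0 < r" for x r
    proof -
      show "0 < c x r" using that \<kappa>(1)[of r] T \<alpha> by (simp add: c_def good_ball_def)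
      have "2 * c x r / T \<le> 2 * (T / 4) / T" using T by (intro divide_right_mono) (auto simp: c_def)
      also have "\<dots> = 1 / 2" using T by simp
      finally show "2 * c x r / T + 2 * L * \<kappa> r / T\<^sup>2 < 1" using \<kappa>(3)[OF that(2)] by linarith
      show "2 * c x r \<le> \<alpha> * \<kappa> r * snd (Am x r)" by (simp add: c_def)
    qed
    define good where "good = (\<lambda>\<rho> xs j. \<exists>A \<mu>. good_ball \<phi> (xs j) (T ^ j * \<rho>) A \<mu>)"
    \<comment> \<open>Two phases: the exceptional points until the first good ball of the play, then
      the windows, with the data of that ball kept fixed. Intersecting with that ball keeps the
      estimates valid for every list of centres, not only for those from legal plays.\<close>
    define Danger where "Danger = (\<lambda>\<rho> xs. if \<exists>j<length xs. good \<rho> ((!) xs) j then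
        (let k = (LEAST j. good \<rho> ((!) xs) j); x = xs ! k; r = T ^ k * \<rho>; s = T ^ (length xs - 1) * \<rho> in
          active_places.dangerous S (fst (Am x r)) (ball_in {0..1} x r \<inter> ball_in {0..1} (last xs) s) \<phi> (c x r)
            (\<kappa> r / s) (\<kappa> r / (T * s)))
        else E)"
    show ?thesis
    \<comment> \<open>In the disjoint sum of index types, \<open>Inl\<close> marks places and
      \<open>Inr\<close> marks exceptional points.\<close>
    proof (rule avoidance_winning[where N = N and Danger = Danger and 'i = "('k \<Rightarrow> complex) + real", OF \<alpha>(1,2) \<beta>])
      fix \<rho> :: real and xs :: "real list" and r :: real
      assume \<rho>: "0 < \<rho>" and xs: "xs \<noteq> []" and r: "r = (\<alpha> * \<beta>) ^ (length xs - 1) * \<rho>"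
      then have r0: "0 < r" using T by (simp add: T_def)
      show "\<exists>(I :: (('k \<Rightarrow> complex) + real) set) D. finite I \<and> card I \<le> N \<and> Danger \<rho> xs \<subseteq> (\<Union>i\<in>I. D i) \<and>
         (\<forall>i\<in>I. \<forall>s\<in>D i. \<forall>t\<in>D i. \<bar>s - t\<bar> \<le> \<alpha> * r)"
      proof (cases "\<exists>j<length xs. good \<rho> ((!) xs) j")
        case False
        show ?thesis
          using False E r0 \<alpha>(1)
          by (intro exI[of _ "Inr ` E"] exI[of _ "\<lambda>i. {projr i}"])
            (auto simp: Danger_def N_def card_image)
      next
        case True
        define k where "k = (LEAST j. good \<rho> ((!) xs) j)"
        define x where "x = xs ! k"
        define r' where "r' = T ^ k * \<rho>"
        have r': "0 < r'" using T \<rho> by (simp add: r'_def)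
        have "good \<rho> ((!) xs) k" unfolding k_def using True by (auto intro: LeastI)
        then have good: "good_ball \<phi> x r' (fst (Am x r')) (snd (Am x r'))"
          unfolding good_def x_def r'_def by (rule Am)
        then interpret active_places S "fst (Am x r')" by (simp add: good_ball_def)
        let ?J = "ball_in {0..1} x r' \<inter> ball_in {0..1} (last xs) r"
        have D: "Danger \<rho> xs = dangerous ?J \<phi> (c x r') (\<kappa> r' / r) (\<kappa> r' / (T * r))"
          using True by (simp add: Danger_def Let_def k_def x_def r'_def r T_def)
        have "\<exists>D. dangerous ?J \<phi> (c x r') (\<kappa> r' / r) (\<kappa> r' / (T * r)) \<subseteq> (\<Union>\<sigma>\<in>fst (Am x r'). D \<sigma>) \<and>
          (\<forall>\<sigma>\<in>fst (Am x r'). \<forall>s\<in>D \<sigma>. \<forall>t\<in>D \<sigma>. \<bar>s - t\<bar> \<le> \<alpha> * r)"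
        proof (rule dangerous_cover[OF _ _ _ r0 T(1) _ \<kappa>(1)[OF r'] c(1)[OF good r'] L(1) _ c(2,3)[OF good r']])
          show "cmod (\<phi> s \<sigma> - \<phi> t \<sigma>) \<le> L * \<bar>s - t\<bar>" if "\<sigma> \<in> S" "s \<in> ?J" "t \<in> ?J" for \<sigma> s t
            using that by (intro L(2)) (auto simp: ball_in_def)
          show "snd (Am x r') * \<bar>s - t\<bar> \<le> cmod (\<phi> s \<sigma> - \<phi> t \<sigma>)"
            if "\<sigma> \<in> fst (Am x r')" "s \<in> ?J" "t \<in> ?J" for \<sigma> s t
            using good that by (auto simp: good_ball_def)
          show "\<bar>s - t\<bar> \<le> 2 * r" if "s \<in> ?J" "t \<in> ?J" for s t
            using that by (auto simp: ball_in_def dist_real_def)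
        qed (use T good in \<open>auto simp: good_ball_def\<close>)
        then obtain D where D': "Danger \<rho> xs \<subseteq> (\<Union>\<sigma>\<in>fst (Am x r'). D \<sigma>)"
          "\<forall>\<sigma>\<in>fst (Am x r'). \<forall>s\<in>D \<sigma>. \<forall>t\<in>D \<sigma>. \<bar>s - t\<bar> \<le> \<alpha> * r" unfolding D by blast
        have "card (fst (Am x r')) \<le> N" using A_subset finite_S by (auto simp: N_def intro: trans_le_add1 card_mono)
        then show ?thesis using D' finite_A
          by (intro exI[of _ "Inl ` fst (Am x r')"] exI[of _ "\<lambda>i. D (projl i)"]) (auto simp: card_image)
      qed
    next
      fix \<rho> w :: real and x :: "nat \<Rightarrow> real"
      assume \<rho>: "0 < \<rho>" and w_in: "\<And>n. w \<in> ball_in {0..1} (x n) ((\<alpha> * \<beta>) ^ n * \<rho>)"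
        and esc: "\<And>n. (\<alpha> * \<beta>) ^ n * \<rho> \<le> 1/2 \<Longrightarrow> w \<notin> Danger \<rho> (map x [0..<Suc n])"
      have w: "w \<in> {0..1}" using w_in[of 0] by (simp add: ball_in_def)
      have wT: "w \<in> ball_in {0..1} (x n) (T ^ n * \<rho>)" for n using w_in[of n] by (simp add: T_def)
      have lim: "(\<lambda>n. T ^ n * \<rho>) \<longlonglongrightarrow> 0" using T by (intro tendsto_mult_left_zero LIMSEQ_realpow_zero) auto
      have nth: "map x [0..<Suc n] ! j = x j" if "j \<le> n" for n j using that by (simp del: upt_Suc)
      have cong: "good \<rho> ((!) (map x [0..<Suc n])) j \<longleftrightarrow> good \<rho> x j" if "j \<le> n" for n j
        unfolding good_def nth[OF that] ..
      \<comment> \<open>Without a good ball Player B would have avoided \<open>E\<close>, so the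
        outcome would be a nondegenerate point, and all sufficiently small balls containing it would
        be good.\<close>
      have "\<exists>k. good \<rho> x k"
      proof (rule ccontr)
        assume none: "\<nexists>k. good \<rho> x k"
        have "eventually (\<lambda>n. T ^ n * \<rho> < 1/2) sequentially" by (intro order_tendstoD(2)[OF lim]) simp
        then obtain n where n: "T ^ n * \<rho> < 1/2" by (auto simp: eventually_sequentially)
        have "\<not> (\<exists>j<length (map x [0..<Suc n]). good \<rho> ((!) (map x [0..<Suc n])) j)"
          using none cong[of _ n] by (auto simp: less_Suc_eq_le simp del: upt_Suc)
        then have "Danger \<rho> (map x [0..<Suc n]) = E" by (simp only: Danger_def if_False)
        then have "w \<in> {0..1} - E" using esc[of n] n w by (simp add: T_def)
        then obtain A where A: "A \<subseteq> S" "\<forall>\<sigma>\<in>A. \<phi>' w \<sigma> \<noteq> 0"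
          "field_degree TYPE('k) div 2 < card {\<sigma> \<in> A. real_embedding \<sigma>} + 2 * card {\<sigma> \<in> A. complex_embedding \<sigma>}"
          using nondeg by blast
        have "\<exists>\<delta>>0. \<exists>\<mu>. \<forall>x r. w \<in> ball_in {0..1} x r \<longrightarrow> r < \<delta> \<longrightarrow> good_ball \<phi> x r A \<mu>"
          by (rule nearby_good_ball[where \<phi>' = \<phi>', OF d cont w A(1) _ A(3)]) (use A(2) in auto)
        then obtain \<delta> \<mu> where \<delta>: "0 < \<delta>" "\<And>y r. w \<in> ball_in {0..1} y r \<Longrightarrow> r < \<delta> \<Longrightarrow> good_ball \<phi> y r A \<mu>"
          by blast
        have "eventually (\<lambda>n. T ^ n * \<rho> < \<delta>) sequentially" by (rule order_tendstoD(2)[OF lim \<delta>(1)])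
        then obtain n where "T ^ n * \<rho> < \<delta>" by (auto simp: eventually_sequentially)
        then have "good \<rho> x n" unfolding good_def using \<delta>(2)[OF wT] by blast
        then show False using none by blast
      qed
      define k where "k = (LEAST j. good \<rho> x j)"
      have gk: "good \<rho> x k" unfolding k_def using \<open>\<exists>k. good \<rho> x k\<close> by (rule LeastI_ex)
      define r' where "r' = T ^ k * \<rho>"
      have r': "0 < r'" using T \<rho> by (simp add: r'_def)
      have good: "good_ball \<phi> (x k) r' (fst (Am (x k) r')) (snd (Am (x k) r'))"
        using gk unfolding good_def r'_def by (rule Am)
      \<comment> \<open>Later stages see the same first good ball, hence the same constants.\<close>
      have least: "(LEAST j. good \<rho> ((!) (map x [0..<Suc n])) j) = k" if n: "k \<le> n" for n
      proof (rule Least_equality)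
        show "good \<rho> ((!) (map x [0..<Suc n])) k" using gk cong[OF n] by blast
        fix j assume j: "good \<rho> ((!) (map x [0..<Suc n])) j"
        show "k \<le> j"
        proof (rule ccontr)
          assume "\<not> k \<le> j"
          then have "good \<rho> x j" "j < k" using j cong[of j n] n by auto
          then show False using not_less_Least[of j "good \<rho> x"] unfolding k_def by blast
        qed
      qed
      have "\<phi> w \<in> Bad S"
      proof (rule escape_imp_Bad[where A = "fst (Am (x k) r')" and T = T and \<rho> = \<rho> and k = k
          and c = "c (x k) r'" and \<kappa> = "\<kappa> r'" and J = "\<lambda>n. ball_in {0..1} (x k) r' \<inter> ball_in {0..1} (x n) (T ^ n * \<rho>)"])
        show "active_places S (fst (Am (x k) r'))" using good by (simp add: good_ball_def)
        show "\<phi> w \<in> K_space S" using \<phi> w by auto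
        show "0 < c (x k) r'" by (rule c(1)[OF good r'])
        show "0 < \<kappa> r'" "\<kappa> r' \<le> T ^ k * \<rho>" using \<kappa>(1,2)[OF r'] by (auto simp: r'_def)
        show "w \<in> ball_in {0..1} (x k) r' \<inter> ball_in {0..1} (x n) (T ^ n * \<rho>)" for n
          using wT[of k] wT[of n] by (simp add: r'_def)
        fix n assume n: "k \<le> n"
        have "T ^ n * \<rho> \<le> r'" unfolding r'_def using T \<rho> n by (intro mult_right_mono power_decreasing) auto
        then have "T ^ n * \<rho> \<le> 1/2" using good by (simp add: good_ball_def)
        then have notin: "w \<notin> Danger \<rho> (map x [0..<Suc n])" using esc[of n] by (simp add: T_def)
        have ex: "\<exists>j<length (map x [0..<Suc n]). good \<rho> ((!) (map x [0..<Suc n])) j"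
          using gk cong[OF n] n by (intro exI[of _ k]) (auto simp del: upt_Suc)
        have len: "length (map x [0..<Suc n]) - 1 = n" "last (map x [0..<Suc n]) = x n" by simp_all
        have "Danger \<rho> (map x [0..<Suc n]) = active_places.dangerous S (fst (Am (x k) r'))
            (ball_in {0..1} (x k) r' \<inter> ball_in {0..1} (x n) (T ^ n * \<rho>)) \<phi> (c (x k) r')
            (\<kappa> r' / (T ^ n * \<rho>)) (\<kappa> r' / (T * (T ^ n * \<rho>)))"
          unfolding Danger_def if_P[OF ex] Let_def least[OF n] len nth[OF n] r'_def ..
        then show "w \<notin> active_places.dangerous S (fst (Am (x k) r'))
            (ball_in {0..1} (x k) r' \<inter> ball_in {0..1} (x n) (T ^ n * \<rho>)) \<phi> (c (x k) r')
            (\<kappa> r' / (T ^ n * \<rho>)) (\<kappa> r' / (T * (T ^ n * \<rho>)))" using notin by simp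
      qed (use T \<rho> in auto)
      then show "w \<in> {x \<in> {0..1}. \<phi> x \<in> Bad S}" using w by simp
    qed auto
  qed
  then have "alpha_winning {0..1} \<alpha> {x \<in> {0..1}. \<phi> x \<in> Bad S}" by (simp add: alpha_winning_def)
  then show ?thesis using \<alpha> by (auto simp: schmidt_winning_def)
qed

end

theorem corollary1p2:
  fixes S :: "('k::field_char_0 \<Rightarrow> complex) set"
    and \<phi> \<phi>' :: "real \<Rightarrow> ('k \<Rightarrow> complex) \<Rightarrow> complex"
  assumes "number_field TYPE('k)"
    and "embedding_representatives S"
    and "\<phi> \<in> {0..1} \<rightarrow> K_space S"
    and "\<And>\<sigma> x. \<sigma> \<in> S \<Longrightarrow> x \<in> {0..1} \<Longrightarrow>
           ((\<lambda>t. \<phi> t \<sigma>) has_vector_derivative \<phi>' x \<sigma>) (at x within {0..1})"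
    and "\<And>\<sigma>. \<sigma> \<in> S \<Longrightarrow> continuous_on {0..1} (\<lambda>t. \<phi>' t \<sigma>)"
    and "finite {x \<in> {0..1}. \<not> (\<exists>S'\<subseteq>S. (\<forall>\<sigma>\<in>S'. \<phi>' x \<sigma> \<noteq> 0) \<and>
           card {\<sigma> \<in> S'. real_embedding \<sigma>} + 2 * card {\<sigma> \<in> S'. complex_embedding \<sigma>}
             > field_degree TYPE('k) div 2)}"
  shows "schmidt_winning {0..1} {x \<in> {0..1}. \<phi> x \<in> Bad S} \<and>
         hausdorff_dim {x \<in> {0..1}. \<phi> x \<in> Bad S} = 1"
proof -
  interpret represented_numfield S using assms(1,2) by unfold_locales
  have "schmidt_winning {0..1} {x \<in> {0..1}. \<phi> x \<in> Bad S}"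
    by (rule badly_approximable_winning[OF assms(3-6)]) blast+
  then show ?thesis using winning_hausdorff_dim by blast
qed

end
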